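(* Let $A,B\in\mathcal{M}_n$ be positive (semidefinite) matrices, let $\|\cdot\|$ be a unitarily invariant norm on $\mathcal{M}_n$, and let $f$ be a $g$-convex function on the interval $[0,\infty)$ with $(g\circ f)(0)\le 0$ and $g(0)\ge 0$. Then $$\left\|f(A)+f(B)\right\|\le \left\|g^{-1}\big((g\circ f)(A)+(g\circ f)(B)\big)\right\|\le \left\|f(A+B)\right\|.$$
   Context: $\mathcal{M}_n$ is the algebra of $n\times n$ complex matrices; functions of Hermitian matrices are defined by functional calculus. Let $J,J_2,J_3\subseteq\mathbb{R}$ be intervals. A continuous function $f:J\to J_2$ is called $g$-convex on $J$ if $g:J_2\to J_3$ is (strictly) increasing and concave on $J_2$ and $g\circ f:J\to J_3$ is convex; here $J=[0,\infty)$. $g^{-1}$ denotes the inverse of $g$, defined on $g(J_2)$. It is implicit that $0\in J_2$ and that the spectrum of $(g\circ f)(A)+(g\circ f)(B)$ lies in the domain of $g^{-1}$.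
   Formalization: The formal statement additionally assumes f(t) ≥ 0 for all t ≥ 0; without this the claim is false, e.g. g(t)=t, f(t)=t−1, A=B=0 would require |−2| ≤ |−1|. *)

theory Defs
  imports "HOL-Analysis.Analysis"
begin

definition cadjoint :: "complex^'n^'n \<Rightarrow> complex^'n^'n" where
  "cadjoint A = (\<chi> i j. cnj (A $ j $ i))"

definition hermitian :: "complex^'n^'n \<Rightarrow> bool" where
  "hermitian A \<longleftrightarrow> cadjoint A = A"

definition unitary :: "complex^'n^'n \<Rightarrow> bool" where
  "unitary U \<longleftrightarrow> cadjoint U ** U = mat 1 \<and> U ** cadjoint U = mat 1"

text \<open>For Hermitian \<open>A\<close> the quadratic form below is real, so taking its real part loses nothing.\<close>

definition pos_semidef :: "complex^'n^'n \<Rightarrow> bool" where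
  "pos_semidef A \<longleftrightarrow> hermitian A \<and> (\<forall>x. 0 \<le> Re (\<Sum>i\<in>UNIV. cnj (x $ i) * (A *v x) $ i))"

definition eigenvalues :: "complex^'n^'n \<Rightarrow> complex set" where
  "eigenvalues A = {c. \<exists>v. v \<noteq> 0 \<and> A *v v = c *s v}"

definition rdiag :: "('n \<Rightarrow> real) \<Rightarrow> complex^'n^'n" where
  "rdiag d = (\<chi> i j. if i = j then complex_of_real (d i) else 0)"

text \<open>Functional calculus: if \<open>A = U diag(d) U*\<close> with \<open>U\<close> unitary and \<open>d\<close> real, then
  \<open>f(A) = U diag(f \<circ> d) U*\<close>.  The lemma \<open>mat_fun_eq\<close> shows that the result does not depend on
  the chosen diagonalization; only the values of \<open>f\<close> on the spectrum of \<open>A\<close> matter.  The value is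
  meaningful only for Hermitian \<open>A\<close>, i.e. when such a diagonalization exists.\<close>

definition mat_fun :: "(real \<Rightarrow> real) \<Rightarrow> complex^'n^'n \<Rightarrow> complex^'n^'n" where
  "mat_fun f A = (THE X. \<exists>U d. unitary U \<and> A = U ** rdiag d ** cadjoint U
                               \<and> X = U ** rdiag (f \<circ> d) ** cadjoint U)"

lemma rdiag_mult_left: "(rdiag d ** A) $ i $ j = complex_of_real (d i) * A $ i $ j"
  by (simp add: rdiag_def matrix_matrix_mult_def if_distrib[of "\<lambda>x. x * _"] cong: if_cong)

lemma rdiag_mult_right: "(A ** rdiag d) $ i $ j = A $ i $ j * complex_of_real (d j)"
  by (simp add: rdiag_def matrix_matrix_mult_def if_distrib[of "\<lambda>x. _ * x"] cong: if_cong)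

lemma diagonalization_fun_unique:
  fixes U V :: "complex^'n^'n"
  assumes U: "unitary U" and V: "unitary V"
    and eq: "U ** rdiag d ** cadjoint U = V ** rdiag e ** cadjoint V"
  shows "U ** rdiag (f \<circ> d) ** cadjoint U = V ** rdiag (f \<circ> e) ** cadjoint V"
proof -
  have UU: "cadjoint U ** U = mat 1" "U ** cadjoint U = mat 1"
    and VV: "cadjoint V ** V = mat 1" "V ** cadjoint V = mat 1"
    using U V by (auto simp: unitary_def)
  define W where "W = cadjoint V ** U"
  have "W ** rdiag d = cadjoint V ** (U ** rdiag d ** cadjoint U) ** U"
    by (metis W_def UU(1) matrix_mul_assoc matrix_mul_rid)
  also have "\<dots> = rdiag e ** W"
    unfolding eq by (metis W_def VV(1) matrix_mul_assoc matrix_mul_lid)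
  finally have comm: "W ** rdiag d = rdiag e ** W" .
  have "W ** rdiag (f \<circ> d) = rdiag (f \<circ> e) ** W"
  proof -
    have "W $ i $ j * complex_of_real (f (d j)) = complex_of_real (f (e i)) * W $ i $ j" for i j
    proof -
      have "W $ i $ j * complex_of_real (d j) = complex_of_real (e i) * W $ i $ j"
        using comm by (metis rdiag_mult_left rdiag_mult_right)
      then have "W $ i $ j = 0 \<or> d j = e i"
        by (simp add: mult.commute)
      then show ?thesis by auto
    qed
    then show ?thesis
      by (simp add: vec_eq_iff rdiag_mult_left rdiag_mult_right)
  qed
  then have "V ** (W ** rdiag (f \<circ> d)) ** cadjoint U = V ** (rdiag (f \<circ> e) ** W) ** cadjoint U"
    by simp
  moreover have "V ** (W ** rdiag (f \<circ> d)) ** cadjoint U = U ** rdiag (f \<circ> d) ** cadjoint U"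
    by (metis W_def VV(2) matrix_mul_assoc matrix_mul_lid)
  moreover have "V ** (rdiag (f \<circ> e) ** W) ** cadjoint U = V ** rdiag (f \<circ> e) ** cadjoint V"
    by (metis W_def UU(2) matrix_mul_assoc matrix_mul_rid)
  ultimately show ?thesis by simp
qed

lemma mat_fun_eq:
  assumes "unitary U"
  shows "mat_fun f (U ** rdiag d ** cadjoint U) = U ** rdiag (f \<circ> d) ** cadjoint U"
  unfolding mat_fun_def
proof (rule the_equality)
  fix X
  assume "\<exists>V e. unitary V \<and> U ** rdiag d ** cadjoint U = V ** rdiag e ** cadjoint V
                \<and> X = V ** rdiag (f \<circ> e) ** cadjoint V"
  then show "X = U ** rdiag (f \<circ> d) ** cadjoint U"
    using diagonalization_fun_unique[OF assms] by metis
qed (use assms in blast)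

definition matrix_norm :: "(complex^'n^'n \<Rightarrow> real) \<Rightarrow> bool" where
  "matrix_norm N \<longleftrightarrow>
     (\<forall>A. 0 \<le> N A) \<and>
     (\<forall>A. N A = 0 \<longleftrightarrow> A = 0) \<and>
     (\<forall>c A. N (\<chi> i j. c * A $ i $ j) = cmod c * N A) \<and>
     (\<forall>A B. N (A + B) \<le> N A + N B)"

definition unitarily_invariant_norm :: "(complex^'n^'n \<Rightarrow> real) \<Rightarrow> bool" where
  "unitarily_invariant_norm N \<longleftrightarrow>
     matrix_norm N \<and> (\<forall>U V A. unitary U \<longrightarrow> unitary V \<longrightarrow> N (U ** A ** V) = N A)"

definition g_convex_on ::
    "real set \<Rightarrow> real set \<Rightarrow> real set \<Rightarrow> (real \<Rightarrow> real) \<Rightarrow> (real \<Rightarrow> real) \<Rightarrow> bool" where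
  "g_convex_on J J\<^sub>2 J\<^sub>3 g f \<longleftrightarrow>
     is_interval J \<and> is_interval J\<^sub>2 \<and> is_interval J\<^sub>3 \<and>
     continuous_on J f \<and> f ` J \<subseteq> J\<^sub>2 \<and> g ` J\<^sub>2 \<subseteq> J\<^sub>3 \<and>
     strict_mono_on J\<^sub>2 g \<and> concave_on J\<^sub>2 g \<and> convex_on J (g \<circ> f)"

end

theory Submission
  imports Defs
begin

text \<open>The hypotheses force \<open>f 0 = g 0 = 0\<close>, so \<open>h = g \<circ> f\<close> and \<open>k = g\<inverse>\<close> are nonnegative, convex and vanish at
  \<open>0\<close>. For every such function \<open>\<phi>\<close> and positive semidefinite \<open>X\<close>, \<open>Y\<close>, the eigenvalues of
  \<open>\<phi>(X) + \<phi>(Y)\<close> are weakly majorized by those of \<open>\<phi>(X + Y)\<close>. Only the values of \<open>\<phi>\<close> on finitely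
  many points matter, and there \<open>\<phi>\<close> is a nonnegative combination of angle functions
  \<open>t \<mapsto> (t - b)\<^sub>+\<close>; as these are all increasing, one may assume \<open>\<phi>(t) = (t - b)\<^sub>+\<close>. Put
  \<open>Z = (X - b)\<^sub>+ + (Y - b)\<^sub>+\<close> and let \<open>P\<close>, \<open>Q\<close> be the range projections of the two summands.
  Since \<open>X + Y \<ge> Z + b (P + Q)\<close>, it suffices that \<open>tr (E (P + Q)) \<ge> tr E\<close> for the spectral projections \<open>E\<close> of
  the largest nonzero eigenvalues of \<open>Z\<close>. This holds because \<open>P \<ge> M Z\<inverse> M\<close> for the square root \<open>M\<close> of
  \<open>(X - b)\<^sub>+\<close> (likewise for \<open>Q\<close>), and because \<open>E\<close> and \<open>-Z\<inverse>\<close> are similarly ordered, so that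
  \<open>tr (E M Z\<inverse> M) \<ge> tr (M\<^sup>2 E Z\<inverse>)\<close>.

  Taking \<open>\<phi> = k\<close>, \<open>X = h(A)\<close>, \<open>Y = h(B)\<close> gives the first inequality. The second one follows from
  \<open>\<phi> = h\<close>, as \<open>k\<close> preserves weak majorization. Weak majorization passes to unitarily invariant norms
  by Ky Fan dominance.\<close>

subsection \<open>Spectral theorem\<close>

lemma cadjoint_nth: "cadjoint A $ i $ j = cnj (A $ j $ i)"
  by (simp add: cadjoint_def)

lemma cadjoint_cadjoint [simp]: "cadjoint (cadjoint A) = A"
  by (simp add: vec_eq_iff cadjoint_nth)

lemma cadjoint_mult: "cadjoint (A ** B) = cadjoint B ** cadjoint A"
  by (simp add: vec_eq_iff cadjoint_nth matrix_matrix_mult_def mult.commute)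

lemma unitary_mult: "unitary U \<Longrightarrow> unitary V \<Longrightarrow> unitary (U ** V)"
  unfolding unitary_def cadjoint_mult by (metis matrix_mul_assoc matrix_mul_lid)

lemma unitary_cadjoint: "unitary U \<Longrightarrow> unitary (cadjoint U)"
  by (simp add: unitary_def)

lemma unitary_row_sum:
  assumes "unitary U"
  shows "(\<Sum>k\<in>UNIV. (cmod (U $ i $ k))\<^sup>2) = 1"
proof -
  have "(U ** cadjoint U) $ i $ i = 1"
    using assms by (simp add: unitary_def mat_def)
  then have "(\<Sum>k\<in>UNIV. complex_of_real ((cmod (U $ i $ k))\<^sup>2)) = 1"
    by (simp add: matrix_matrix_mult_def cadjoint_nth complex_norm_square del: of_real_power)
  then show ?thesis
    using of_real_eq_1_iff of_real_sum by metis
qed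

lemma unitary_col_sum:
  assumes "unitary U"
  shows "(\<Sum>k\<in>UNIV. (cmod (U $ k $ i))\<^sup>2) = 1"
  using unitary_row_sum[OF unitary_cadjoint[OF assms], of i] by (simp add: cadjoint_nth)

text \<open>The \<open>inner\<close> of this type is real valued; complex orthogonality needs the
  full form.\<close>

definition cip :: "complex^'n \<Rightarrow> complex^'n \<Rightarrow> complex" where
  "cip x y = (\<Sum>i\<in>UNIV. cnj (x $ i) * y $ i)"

lemma Re_cip: "Re (cip x y) = inner x y"
  by (simp add: cip_def inner_vec_def inner_complex_def)

lemma cip_simps:
  "cip x (y + z) = cip x y + cip x z" "cip x (y - z) = cip x y - cip x z"
  "cip x (c *s y) = c * cip x y" "cip (c *s x) y = cnj c * cip x y"
  "cip x (r *\<^sub>R y) = of_real r * cip x y"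
  by (simp_all add: cip_def algebra_simps sum.distrib sum_subtractf sum_distrib_left scaleR_sum_right)
    (simp add: scaleR_conv_of_real)

lemma cnj_cip: "cnj (cip x y) = cip y x"
  by (simp add: cip_def mult.commute)

lemma cip_self: "cip x x = of_real ((norm x)\<^sup>2)"
proof (rule complex_eqI)
  show "Re (cip x x) = Re (of_real ((norm x)\<^sup>2))"
    by (simp add: Re_cip dot_square_norm)
  show "Im (cip x x) = Im (of_real ((norm x)\<^sup>2))"
    by (simp add: cip_def mult.commute)
qed

lemma cip_adjoint: "cip x (A *v y) = cip (cadjoint A *v x) y"
proof -
  have "cip x (A *v y) = (\<Sum>i\<in>UNIV. \<Sum>j\<in>UNIV. cnj (x $ i) * (A $ i $ j * y $ j))"
    by (simp add: cip_def matrix_vector_mult_def sum_distrib_left)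
  also have "\<dots> = (\<Sum>j\<in>UNIV. \<Sum>i\<in>UNIV. cnj (x $ i) * (A $ i $ j * y $ j))"
    by (rule sum.swap)
  also have "\<dots> = cip (cadjoint A *v x) y"
    by (simp add: cip_def matrix_vector_mult_def cadjoint_nth sum_distrib_left sum_distrib_right mult_ac)
  finally show ?thesis .
qed

text \<open>The conjugated \<open>v i\<close> fill the rows in \<open>I\<close> of a square matrix
  whose row \<open>j\<close> stays zero, so it is singular; \<open>x\<close> is a kernel
  vector.\<close>

lemma exists_orthogonal:
  fixes v :: "'n::finite \<Rightarrow> complex^'n"
  assumes "j \<notin> I"
  shows "\<exists>x. x \<noteq> 0 \<and> (\<forall>i\<in>I. cip (v i) x = 0)"
proof -
  define M :: "complex^'n^'n" where "M = (\<chi> i. if i \<in> I then (\<chi> k. cnj (v i $ k)) else 0)"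
  have Mx: "(M *v x) $ i = (if i \<in> I then cip (v i) x else 0)" for x i
    by (simp add: M_def matrix_vector_mult_def cip_def)
  have "row j M = 0"
    using assms by (simp add: M_def row_def vec_eq_iff)
  then have "det M = 0"
    by (rule det_zero_row)
  then have "\<not> (\<exists>B. B ** M = mat 1)"
    using invertible_det_nz invertible_left_inverse by blast
  then obtain x where "M *v x = 0" "x \<noteq> 0"
    unfolding matrix_left_invertible_ker by blast
  then show ?thesis
    using Mx by (metis zero_index)
qed

section \<open>Rayleigh quotient and diagonalization\<close>

lemma continuous_on_matrix_vector:
  "continuous_on S (\<lambda>x::complex^'n. A *v x)"
  unfolding matrix_vector_mult_def by (intro continuous_intros)

text \<open>For small positive \<open>t\<close> the linear term would win: a first-order condition
  at a maximum.\<close>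

lemma quadratic_nonpos_imp:
  fixes a k :: real
  assumes "\<And>t. 2 * t * a + t\<^sup>2 * k \<le> 0"
  shows "a \<le> 0"
proof (rule ccontr)
  assume "\<not> a \<le> 0"
  then have a: "a > 0" by simp
  define t where "t = a / (\<bar>k\<bar> + 1)"
  have t: "t > 0" using a by (simp add: t_def)
  have "t * \<bar>k\<bar> < t * (\<bar>k\<bar> + 1)" using t by simp
  also have "\<dots> = a" by (simp add: t_def)
  finally have "t * \<bar>k\<bar> < a" .
  then have "- (t * k) < a" using t abs_ge_minus_self[of "t*k"] by (simp add: abs_mult)
  then have "0 < t * (2 * a + t * k)" using t a by simp
  then show False using assms[of t] by (simp add: power2_eq_square algebra_simps)
qed

text \<open>Maximize the quadratic form over unit vectors orthogonal to the known eigenvectors. This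
  complement is invariant under \<open>A\<close>, so the residual at the maximizer is an admissible
  direction and must vanish.\<close>

lemma hermitian_next_eigenvector:
  fixes v :: "'n::finite \<Rightarrow> complex^'n" and d :: "'n \<Rightarrow> real"
  assumes A: "hermitian A" and j: "j \<notin> I"
    and ev: "\<And>i. i \<in> I \<Longrightarrow> A *v v i = of_real (d i) *s v i"
  shows "\<exists>x e. norm x = 1 \<and> (\<forall>i\<in>I. cip (v i) x = 0) \<and> A *v x = of_real e *s x"
proof -
  define S where "S = {x. \<forall>i\<in>I. cip (v i) x = 0}"
  define q where "q x = inner x (A *v x)" for x
  have SD: "\<And>x y. x \<in> S \<Longrightarrow> y \<in> S \<Longrightarrow> x + y \<in> S" "\<And>x y. x \<in> S \<Longrightarrow> y \<in> S \<Longrightarrow> x - y \<in> S"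
    "\<And>x r. x \<in> S \<Longrightarrow> r *\<^sub>R x \<in> S"
    by (auto simp: S_def cip_simps)
  have herm: "cip x (A *v y) = cip (A *v x) y" for x y
    using A by (simp add: cip_adjoint hermitian_def)
  have SA: "A *v x \<in> S" if "x \<in> S" for x
    using that ev by (auto simp: S_def cip_simps herm)
  have lin: "A *v (x + y) = A *v x + A *v y" "A *v (r *\<^sub>R x) = r *\<^sub>R (A *v x)" for x y r
    by (simp_all add: vec_eq_iff matrix_vector_mult_def algebra_simps sum.distrib scaleR_sum_right)
  have "S = (\<Inter>i\<in>I. {x. cip (v i) x = 0})"
    by (auto simp: S_def)
  then have "closed S"
    by (simp only: cip_def) (intro closed_INT ballI closed_Collect_eq continuous_intros)
  then have "compact (sphere 0 1 \<inter> S)"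
    by (intro compact_Int_closed) auto
  moreover have "sphere 0 1 \<inter> S \<noteq> {}"
  proof -
    obtain x where x: "x \<noteq> 0" "x \<in> S"
      using exists_orthogonal[OF j, of v] by (auto simp: S_def)
    then have "(1 / norm x) *\<^sub>R x \<in> sphere 0 1 \<inter> S"
      using SD(3)[OF x(2)] by simp
    then show ?thesis by blast
  qed
  moreover have "continuous_on (sphere 0 1 \<inter> S) q"
    unfolding q_def by (intro continuous_intros continuous_on_matrix_vector)
  ultimately obtain u where u: "u \<in> sphere 0 1 \<inter> S" and max: "\<And>x. x \<in> sphere 0 1 \<inter> S \<Longrightarrow> q x \<le> q u"
    using continuous_attains_sup by metis
  have uS: "u \<in> S" and nu: "norm u = 1" using u by auto
  have le: "q z \<le> q u * (norm z)\<^sup>2" if "z \<in> S" for z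
  proof (cases "z = 0")
    case False
    have "q ((1 / norm z) *\<^sub>R z) \<le> q u"
      using False SD(3)[OF that] by (intro max) simp
    moreover have "q ((1 / norm z) *\<^sub>R z) = q z / (norm z)\<^sup>2"
      by (simp add: q_def lin power2_eq_square)
    ultimately show ?thesis
      using False by (simp add: field_simps)
  qed (simp add: q_def)
  \<comment> \<open>Half the gradient at \<open>u\<close> of
    \<open>q x - q u * (norm x)\<^sup>2\<close>, a function that is at most 0 on \<open>S\<close>
    and vanishes at \<open>u\<close>.\<close>
  define w where "w = A *v u - q u *\<^sub>R u"
  have wS: "w \<in> S"
    unfolding w_def by (intro SD SA uS)
  have sym: "inner u (A *v w) = inner w (A *v u)"
    by (metis Re_cip herm inner_commute)
  have "2 * t * (norm w)\<^sup>2 + t\<^sup>2 * (q w - q u * (norm w)\<^sup>2) \<le> 0" for t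
  proof -
    have "q (u + t *\<^sub>R w) \<le> q u * (norm (u + t *\<^sub>R w))\<^sup>2"
      by (intro le SD uS wS)
    moreover have "q (u + t *\<^sub>R w) = q u + 2 * t * inner w (A *v u) + t\<^sup>2 * q w"
      by (simp add: q_def lin inner_simps sym power2_eq_square algebra_simps)
    moreover have "(norm (u + t *\<^sub>R w))\<^sup>2 = 1 + 2 * t * inner w u + t\<^sup>2 * (norm w)\<^sup>2"
      unfolding power2_norm_eq_inner
      using nu by (simp add: inner_simps norm_eq_1 inner_commute power2_eq_square algebra_simps)
    moreover have "(norm w)\<^sup>2 = inner w (A *v u) - q u * inner w u"
    proof -
      have "(norm w)\<^sup>2 = inner w (A *v u - q u *\<^sub>R u)"
        by (simp add: power2_norm_eq_inner w_def)
      then show ?thesis by (simp add: inner_simps)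
    qed
    ultimately have le: "q u + 2 * t * inner w (A *v u) + t\<^sup>2 * q w
        \<le> q u * (1 + 2 * t * inner w u + t\<^sup>2 * (norm w)\<^sup>2)"
      and n: "2 * t * (norm w)\<^sup>2 = 2 * t * (inner w (A *v u) - q u * inner w u)"
      by simp_all
    show ?thesis using le unfolding n by (simp add: algebra_simps)
  qed
  then have "(norm w)\<^sup>2 \<le> 0"
    by (rule quadratic_nonpos_imp)
  then have "A *v u = of_real (q u) *s u"
    by (simp add: w_def vec_eq_iff) (simp add: scaleR_conv_of_real)
  then show ?thesis
    using nu uS unfolding S_def by blast
qed

text \<open>Orthonormal eigenvectors are added one index at a time; indexed by \<open>'n\<close>
  itself, they become the columns of \<open>U\<close>.\<close>

lemma hermitian_diagonalizable:
  fixes A :: "complex^'n^'n"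
  assumes "hermitian A"
  shows "\<exists>U d. unitary U \<and> A = U ** rdiag d ** cadjoint U"
proof -
  have "\<exists>(v :: 'n \<Rightarrow> complex^'n) d. (\<forall>i\<in>I. A *v v i = of_real (d i) *s v i) \<and>
          (\<forall>i\<in>I. \<forall>j\<in>I. cip (v i) (v j) = (if i = j then 1 else 0))" for I :: "'n set"
  proof (induction I rule: finite_induct[OF finite])
    case (2 k I)
    then obtain v d where ev: "\<And>i. i \<in> I \<Longrightarrow> A *v v i = of_real (d i) *s v i"
      and on: "\<And>i j. i \<in> I \<Longrightarrow> j \<in> I \<Longrightarrow> cip (v i) (v j) = (if i = j then 1 else 0)"
      by blast
    obtain x e where x: "norm x = 1" "\<And>i. i \<in> I \<Longrightarrow> cip (v i) x = 0" "A *v x = of_real e *s x"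
      using hermitian_next_eigenvector[OF assms \<open>k \<notin> I\<close>, of v d] ev by blast
    have x': "cip x (v i) = 0" if "i \<in> I" for i
      using x(2)[OF that] by (metis cnj_cip complex_cnj_zero)
    have "cip x x = 1" by (simp add: cip_self x)
    then show ?case
      using ev on x x' \<open>k \<notin> I\<close>
      by (intro exI[of _ "v(k := x)"] exI[of _ "d(k := e)"]) auto
  qed simp
  from this[of UNIV] obtain v :: "'n \<Rightarrow> complex^'n" and d
    where ev: "A *v v i = of_real (d i) *s v i"
      and on: "cip (v i) (v j) = (if i = j then 1 else 0)" for i j
    by auto
  define U :: "complex^'n^'n" where "U = (\<chi> i j. v j $ i)"
  have "cadjoint U ** U = mat 1"
    using on by (simp add: vec_eq_iff matrix_matrix_mult_def cadjoint_nth U_def mat_def cip_def)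
  then have U: "unitary U"
    by (simp add: unitary_def matrix_left_right_inverse[of U "cadjoint U"])
  have "(A ** U) $ i $ j = (U ** rdiag d) $ i $ j" for i j
    unfolding rdiag_mult_right using arg_cong[OF ev[of j], of "\<lambda>x. x $ i"]
    by (simp add: U_def matrix_matrix_mult_def matrix_vector_mult_def mult.commute)
  then have "A ** U = U ** rdiag d"
    by (simp add: vec_eq_iff)
  then have "A = U ** rdiag d ** cadjoint U"
    using U by (metis matrix_mul_assoc matrix_mul_rid unitary_def)
  with U show ?thesis by blast
qed

subsection \<open>Weak majorization\<close>

text \<open>Replaces sorting: \<open>sum y J\<close> is the sum of the \<open>card J\<close> largest
  entries. Ties may be cut anywhere, so one \<open>J\<close> can serve several functions.\<close>

definition is_top :: "'n set \<Rightarrow> ('n \<Rightarrow> real) \<Rightarrow> bool" where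
  "is_top J y \<longleftrightarrow> (\<forall>i\<in>J. \<forall>j. j \<notin> J \<longrightarrow> y j \<le> y i)"

text \<open>With \<open>\<tau>\<close> the least entry on \<open>J\<close>, moving weight into
  \<open>J\<close> trades values at most \<open>\<tau>\<close> for values at least
  \<open>\<tau>\<close>; spare total weight only helps as \<open>\<tau> \<ge> 0\<close>.\<close>

lemma top_weights:
  fixes y w :: "'n::finite \<Rightarrow> real"
  assumes top: "is_top J y" and y: "\<And>i. 0 \<le> y i"
    and w: "\<And>i. 0 \<le> w i" "\<And>i. w i \<le> 1" and sw: "(\<Sum>i\<in>UNIV. w i) \<le> real (card J)"
  shows "(\<Sum>i\<in>UNIV. w i * y i) \<le> (\<Sum>i\<in>J. y i)"
proof (cases "J = {}")
  case True
  then have "w i = 0" for i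
    using w(1) sw by (metis UNIV_I card.empty finite of_nat_0 order_antisym sum_nonneg sum_nonneg_eq_0_iff)
  then show ?thesis using True by simp
next
  case False
  define \<tau> where "\<tau> = Min (y ` J)"
  have \<tau>1: "\<tau> \<le> y i" if "i \<in> J" for i
    using that by (simp add: \<tau>_def)
  have "\<tau> \<in> y ` J" using False by (simp add: \<tau>_def)
  then have \<tau>2: "y i \<le> \<tau>" if "i \<notin> J" for i
    using top that by (auto simp: is_top_def)
  have \<tau>0: "0 \<le> \<tau>" using \<open>\<tau> \<in> y ` J\<close> y by auto
  have "w i * y i - (if i \<in> J then y i else 0) \<le> \<tau> * (w i - (if i \<in> J then 1 else 0))" for i
  proof (cases "i \<in> J")
    case True
    then have "(1 - w i) * \<tau> \<le> (1 - w i) * y i"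
      using \<tau>1 w(2) by (intro mult_left_mono) auto
    then show ?thesis using True by (simp add: algebra_simps)
  next
    case False
    then show ?thesis using mult_left_mono[OF \<tau>2 w(1)] by (simp add: algebra_simps)
  qed
  then have "(\<Sum>i\<in>UNIV. w i * y i - (if i \<in> J then y i else 0))
      \<le> (\<Sum>i\<in>UNIV. \<tau> * (w i - (if i \<in> J then 1 else 0)))"
    by (rule sum_mono)
  also have "\<dots> = \<tau> * ((\<Sum>i\<in>UNIV. w i) - card J)"
    by (simp add: sum_distrib_left[symmetric] sum_subtractf flip: sum.inter_filter)
  also have "\<dots> \<le> 0" using \<tau>0 sw by (simp add: mult_nonneg_nonpos)
  finally show ?thesis
    by (simp add: sum_subtractf flip: sum.inter_filter)
qed

lemma top_sum:
  fixes y :: "'n::finite \<Rightarrow> real"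
  assumes "is_top J y" "\<And>i. 0 \<le> y i" "card I \<le> card J"
  shows "(\<Sum>i\<in>I. y i) \<le> (\<Sum>i\<in>J. y i)"
  using top_weights[OF assms(1,2), of "\<lambda>i. if i \<in> I then 1 else 0"] assms(3)
  by (simp add: if_distrib[of "\<lambda>x. x * _"] cong: if_cong flip: sum.inter_filter)

lemma is_top_mono:
  assumes "is_top J y" "\<And>i j. y i \<le> y j \<Longrightarrow> x i \<le> x j"
  shows "is_top J x"
  using assms by (auto simp: is_top_def)

section \<open>Decreasing enumerations\<close>

lemma sorted_enumeration:
  fixes y :: "'n::finite \<Rightarrow> real"
  obtains e where "bij_betw e {..<CARD('n)} UNIV"
    "\<And>i j. i \<le> j \<Longrightarrow> j < CARD('n) \<Longrightarrow> y (e j) \<le> y (e i)"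
proof -
  obtain xs0 :: "'n list" where xs0: "set xs0 = UNIV" "distinct xs0"
    using finite_distinct_list[OF finite] by blast
  define xs where "xs = sort_key (\<lambda>i. - y i) xs0"
  have xs: "set xs = UNIV" "distinct xs" "sorted (map (\<lambda>i. - y i) xs)"
    using xs0 by (auto simp: xs_def)
  have len: "length xs = CARD('n)" using distinct_card xs(1,2) by metis
  show ?thesis
  proof (rule that[of "(!) xs"])
    show "bij_betw ((!) xs) {..<CARD('n)} UNIV"
      using bij_betw_nth[of xs "{..<length xs}" UNIV] xs len by simp
    show "y (xs ! j) \<le> y (xs ! i)" if "i \<le> j" "j < CARD('n)" for i j
      using sorted_nth_mono[OF xs(3) that(1)] that len by simp
  qed
qed

lemma is_top_enumeration:
  fixes y :: "'n::finite \<Rightarrow> real"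
  assumes e: "bij_betw e {..<CARD('n)} UNIV"
    and mono: "\<And>i j. i \<le> j \<Longrightarrow> j < CARD('n) \<Longrightarrow> y (e j) \<le> y (e i)"
    and "m \<le> CARD('n)"
  shows "is_top (e ` {..<m}) y" "card (e ` {..<m}) = m"
proof -
  show "is_top (e ` {..<m}) y"
    unfolding is_top_def
  proof (intro ballI allI impI)
    fix i j assume "i \<in> e ` {..<m}" and j: "j \<notin> e ` {..<m}"
    then obtain a where a: "a < m" "i = e a" by auto
    have "j \<in> e ` {..<CARD('n)}" using e by (simp add: bij_betw_def)
    then obtain b where b: "b < CARD('n)" "j = e b" by auto
    then have "a \<le> b" using a j by (metis imageI lessThan_iff linorder_le_less_linear order.strict_trans)
    then show "y j \<le> y i" using mono b a by blast
  qed
  have "inj_on e {..<m}"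
    using e assms(3) by (auto simp: bij_betw_def intro: inj_on_subset)
  then show "card (e ` {..<m}) = m" by (simp add: card_image)
qed

lemma exists_top:
  fixes y :: "'n::finite \<Rightarrow> real"
  shows "\<exists>J. is_top J y \<and> card J = card (I :: 'n set)"
proof -
  obtain e where "bij_betw e {..<CARD('n)} UNIV"
    "\<And>i j. i \<le> j \<Longrightarrow> j < CARD('n) \<Longrightarrow> y (e j) \<le> y (e i)"
    using sorted_enumeration[of y] by blast
  then show ?thesis
    using is_top_enumeration[of e y "card I"] card_mono[of UNIV I] by auto
qed

text \<open>For nonnegative \<open>y\<close> this is the usual comparison of sums of largest
  entries. Admitting smaller \<open>J\<close> allows small entries to be discarded.\<close>

definition weakly_majorized :: "('n \<Rightarrow> real) \<Rightarrow> ('n \<Rightarrow> real) \<Rightarrow> bool" where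
  "weakly_majorized x y \<longleftrightarrow> (\<forall>I. \<exists>J. card J \<le> card I \<and> sum x I \<le> sum y J)"

lemma weakly_majorized_top:
  fixes x y :: "'n::finite \<Rightarrow> real"
  assumes "weakly_majorized x y" "is_top J y" "\<And>i. 0 \<le> y i" "card I \<le> card J"
  shows "sum x I \<le> sum y J"
proof -
  obtain J' where "card J' \<le> card I" "sum x I \<le> sum y J'"
    using assms(1) by (auto simp: weakly_majorized_def)
  then show ?thesis using top_sum[OF assms(2,3), of J'] assms(4) by force
qed

text \<open>Indices with \<open>x i \<le> b\<close> contribute nothing. On the remaining set
  \<open>I'\<close> the shift costs \<open>b * card I'\<close>, at least its cost on the comparison
  set, which is no larger.\<close>

lemma weakly_majorized_angle:
  fixes x y :: "'n::finite \<Rightarrow> real"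
  assumes "weakly_majorized x y" "0 \<le> b"
  shows "weakly_majorized (\<lambda>i. max 0 (x i - b)) (\<lambda>i. max 0 (y i - b))"
  unfolding weakly_majorized_def
proof
  fix I :: "'n set"
  define I' where "I' = {i \<in> I. b < x i}"
  obtain J where J: "card J \<le> card I'" "sum x I' \<le> sum y J"
    using assms(1) by (auto simp: weakly_majorized_def)
  have "(\<Sum>i\<in>I. max 0 (x i - b)) = (\<Sum>i\<in>I'. x i - b)"
    unfolding I'_def sum.inter_filter[OF finite] by (rule sum.cong) auto
  also have "\<dots> = sum x I' - b * card I'" by (simp add: sum_subtractf)
  also have "\<dots> \<le> sum y J - b * card J"
    using J assms(2) by (smt (verit) mult_left_mono of_nat_le_iff)
  also have "\<dots> = (\<Sum>i\<in>J. y i - b)" by (simp add: sum_subtractf)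
  also have "\<dots> \<le> (\<Sum>i\<in>J. max 0 (y i - b))" by (rule sum_mono) simp
  finally show "\<exists>J. card J \<le> card I \<and> (\<Sum>i\<in>I. max 0 (x i - b)) \<le> (\<Sum>i\<in>J. max 0 (y i - b))"
    using J(1) card_mono[of I I'] by (intro exI[of _ J]) (auto simp: I'_def)
qed

text \<open>A set of largest entries of \<open>y\<close> is such a set for every function \<open>max 0 (y - b)\<close>
  simultaneously, so partial sums of largest entries are additive along such combinations.\<close>

lemma weakly_majorized_angle_sum:
  fixes x y :: "'n::finite \<Rightarrow> real"
  assumes wm: "weakly_majorized x y" and D: "\<And>b. b \<in> D \<Longrightarrow> 0 \<le> b" "\<And>b. b \<in> D \<Longrightarrow> 0 \<le> c b"
    and x: "\<And>i. \<phi> (x i) = (\<Sum>b\<in>D. c b * max 0 (x i - b))"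
    and y: "\<And>i. \<phi> (y i) = (\<Sum>b\<in>D. c b * max 0 (y i - b))"
  shows "weakly_majorized (\<phi> \<circ> x) (\<phi> \<circ> y)"
  unfolding weakly_majorized_def
proof
  fix I :: "'n set"
  obtain J where J: "is_top J y" "card J = card I" using exists_top by blast
  have "(\<Sum>i\<in>I. (\<phi> \<circ> x) i) = (\<Sum>b\<in>D. c b * (\<Sum>i\<in>I. max 0 (x i - b)))"
    by (simp add: x sum_distrib_left sum.swap[of _ D])
  also have "\<dots> \<le> (\<Sum>b\<in>D. c b * (\<Sum>i\<in>J. max 0 (y i - b)))"
  proof (intro sum_mono mult_left_mono)
    fix b assume "b \<in> D"
    show "(\<Sum>i\<in>I. max 0 (x i - b)) \<le> (\<Sum>i\<in>J. max 0 (y i - b))"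
      using weakly_majorized_angle[OF wm D(1)[OF \<open>b \<in> D\<close>]] is_top_mono[OF J(1)] J(2)
      by (intro weakly_majorized_top) auto
  qed (use D in auto)
  also have "\<dots> = (\<Sum>i\<in>J. (\<phi> \<circ> y) i)"
    by (simp add: y sum_distrib_left sum.swap[of _ D])
  finally show "\<exists>J. card J \<le> card I \<and> sum (\<phi> \<circ> x) I \<le> sum (\<phi> \<circ> y) J"
    using J(2) by (intro exI[of _ J]) simp
qed

text \<open>Summation by parts: each partial sum of \<open>m k * d k\<close> is at least the current
  \<open>m i\<close> times the partial sum of \<open>d\<close>.\<close>

lemma Abel_nonneg:
  fixes m d :: "nat \<Rightarrow> real"
  assumes "\<And>i j. i \<le> j \<Longrightarrow> j < n \<Longrightarrow> m j \<le> m i" "\<And>i. i < n \<Longrightarrow> 0 \<le> m i"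
    and "\<And>j. j \<le> n \<Longrightarrow> 0 \<le> (\<Sum>k<j. d k)"
  shows "0 \<le> (\<Sum>k<n. m k * d k)"
proof -
  have "m i * (\<Sum>k<Suc i. d k) \<le> (\<Sum>k<Suc i. m k * d k)" if "i < n" for i
    using that
  proof (induction i)
    case (Suc i)
    have "m (Suc i) * (\<Sum>k<Suc i. d k) \<le> m i * (\<Sum>k<Suc i. d k)"
      using Suc.prems by (intro mult_right_mono assms) auto
    with Suc show ?case by (simp add: algebra_simps)
  qed simp
  moreover have "0 \<le> m i * (\<Sum>k<Suc i. d k)" if "i < n" for i
    using that by (intro mult_nonneg_nonneg assms) auto
  ultimately show ?thesis
    by (cases n) (auto intro: order_trans)
qed

text \<open>Pair the entries of \<open>m\<close> and \<open>y\<close> in decreasing order; Abel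
  summation leaves only comparisons over initial segments.\<close>

lemma weakly_majorized_rearrange:
  fixes x y m :: "'n::finite \<Rightarrow> real"
  assumes wm: "weakly_majorized x y" and y: "\<And>i. 0 \<le> y i" and m: "\<And>i. 0 \<le> m i"
  shows "\<exists>p. bij p \<and> (\<Sum>i\<in>UNIV. m i * x i) \<le> (\<Sum>i\<in>UNIV. m i * y (p i))"
proof -
  obtain e where e: "bij_betw e {..<CARD('n)} UNIV"
    and em: "\<And>i j. i \<le> j \<Longrightarrow> j < CARD('n) \<Longrightarrow> m (e j) \<le> m (e i)"
    using sorted_enumeration[of m] by blast
  obtain e' where e': "bij_betw e' {..<CARD('n)} UNIV"
    and em': "\<And>i j. i \<le> j \<Longrightarrow> j < CARD('n) \<Longrightarrow> y (e' j) \<le> y (e' i)"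
    using sorted_enumeration[of y] by blast
  define p where "p = e' \<circ> inv_into {..<CARD('n)} e"
  have p: "bij p"
    unfolding p_def by (rule bij_betw_trans[OF bij_betw_inv_into[OF e] e'])
  have pe: "p (e k) = e' k" if "k < CARD('n)" for k
    using that e by (simp add: p_def bij_betw_def inv_into_f_f)
  have "0 \<le> (\<Sum>k<CARD('n). m (e k) * (y (e' k) - x (e k)))"
  proof (rule Abel_nonneg)
    fix j assume j: "j \<le> CARD('n)"
    have inj: "inj_on e {..<j}" "inj_on e' {..<j}"
      using e e' j by (auto simp: bij_betw_def intro: inj_on_subset)
    \<comment> \<open>The index set is arbitrary for \<open>x\<close>, but carries the
      \<open>j\<close> largest entries of \<open>y\<close>.\<close>
    have "sum x (e ` {..<j}) \<le> sum y (e' ` {..<j})"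
      using is_top_enumeration(1)[where y=y, OF e' em' j] inj
      by (intro weakly_majorized_top[OF wm _ y]) (auto simp: card_image)
    then show "0 \<le> (\<Sum>k<j. y (e' k) - x (e k))"
      using inj by (simp add: sum.reindex sum_subtractf)
  qed (use em m in auto)
  then have "0 \<le> (\<Sum>k<CARD('n). m (e k) * (y (p (e k)) - x (e k)))"
    by (simp add: pe)
  also have "\<dots> = (\<Sum>i\<in>UNIV. m i * (y (p i) - x i))"
    by (rule sum.reindex_bij_betw[OF e])
  finally show ?thesis
    using p by (auto simp: algebra_simps sum_subtractf)
qed

subsection \<open>Range projections and diagonal entries\<close>

text \<open>Hermitian matrices are kept in this spectral form, where functional calculus is
  composition with \<open>d\<close>.\<close>

definition conj_diag :: "complex^'n^'n \<Rightarrow> ('n \<Rightarrow> real) \<Rightarrow> complex^'n^'n" where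
  "conj_diag U d = U ** rdiag d ** cadjoint U"

lemma conj_diag_nth:
  "conj_diag U d $ i $ j = (\<Sum>k\<in>UNIV. U $ i $ k * of_real (d k) * cnj (U $ j $ k))"
proof -
  have "conj_diag U d $ i $ j = (\<Sum>k\<in>UNIV. (U ** rdiag d) $ i $ k * cadjoint U $ k $ j)"
    unfolding conj_diag_def by (simp add: matrix_matrix_mult_def)
  then show ?thesis by (simp add: rdiag_mult_right cadjoint_nth)
qed

lemma cadjoint_conj_diag: "cadjoint (conj_diag U d) = conj_diag U d"
  by (simp add: vec_eq_iff cadjoint_nth conj_diag_nth mult_ac)

lemma conj_diag_conj: "V ** conj_diag U d ** cadjoint V = conj_diag (V ** U) d"
  by (simp add: conj_diag_def cadjoint_mult matrix_mul_assoc)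

lemma conj_diag_mult:
  assumes "unitary U"
  shows "conj_diag U d ** conj_diag U e = conj_diag U (\<lambda>i. d i * e i)"
proof -
  have "rdiag d ** rdiag e = rdiag (\<lambda>i. d i * e i)"
    unfolding vec_eq_iff rdiag_mult_left by (simp add: rdiag_def)
  moreover have "conj_diag U d ** conj_diag U e
      = U ** rdiag d ** (cadjoint U ** U) ** rdiag e ** cadjoint U"
    by (simp only: conj_diag_def matrix_mul_assoc)
  moreover have "\<dots> = U ** (rdiag d ** rdiag e) ** cadjoint U"
    using assms by (simp add: unitary_def matrix_mul_assoc)
  ultimately show ?thesis
    by (simp add: conj_diag_def)
qed

lemma conj_diag_add: "conj_diag U d + conj_diag U e = conj_diag U (\<lambda>i. d i + e i)"
  by (simp add: vec_eq_iff conj_diag_nth algebra_simps sum.distrib)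

lemma conj_diag_cadjoint:
  assumes "unitary U"
  shows "cadjoint U ** conj_diag U d ** U = rdiag d"
proof -
  have "cadjoint U ** conj_diag U d ** U = (cadjoint U ** U) ** rdiag d ** (cadjoint U ** U)"
    by (simp only: conj_diag_def matrix_mul_assoc)
  then show ?thesis using assms by (simp add: unitary_def)
qed

text \<open>For unitary \<open>U\<close> and Hermitian \<open>H\<close>, the sum over a set of
  indices is the trace of E H, with E the projection onto the span of those columns of
  \<open>U\<close>.\<close>

definition diag_entry :: "complex^'n^'n \<Rightarrow> complex^'n^'n \<Rightarrow> 'n \<Rightarrow> real" where
  "diag_entry U H i = Re ((cadjoint U ** H ** U) $ i $ i)"

lemma diag_entry_add: "diag_entry U (H + K) i = diag_entry U H i + diag_entry U K i"
  by (simp add: diag_entry_def matrix_matrix_mult_def algebra_simps sum.distrib)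

lemma diag_entry_self: "unitary U \<Longrightarrow> diag_entry U (conj_diag U d) i = d i"
  by (simp add: diag_entry_def conj_diag_cadjoint) (simp add: rdiag_def)

lemma diag_entry_conj_diag:
  "diag_entry U (conj_diag V d) i = (\<Sum>k\<in>UNIV. (cmod ((cadjoint U ** V) $ i $ k))\<^sup>2 * d k)"
proof -
  have "cadjoint U ** conj_diag V d ** U = conj_diag (cadjoint U ** V) d"
    using conj_diag_conj[of "cadjoint U"] by simp
  then have "diag_entry U (conj_diag V d) i
      = (\<Sum>k\<in>UNIV. Re ((cadjoint U ** V) $ i $ k * cnj ((cadjoint U ** V) $ i $ k) * of_real (d k)))"
    by (simp add: diag_entry_def conj_diag_nth mult_ac del: complex_cnj_mult)
  then show ?thesis
    by (simp only: complex_norm_square[symmetric] Re_complex_of_real of_real_mult[symmetric])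
qed

lemma diag_entry_mono:
  "(\<And>k. d k \<le> e k) \<Longrightarrow> diag_entry U (conj_diag V d) i \<le> diag_entry U (conj_diag V e) i"
  unfolding diag_entry_conj_diag by (intro sum_mono mult_left_mono) auto

lemma diag_entry_scale:
  "diag_entry U (conj_diag V (\<lambda>k. c * d k)) i = c * diag_entry U (conj_diag V d) i"
  unfolding diag_entry_conj_diag by (simp add: sum_distrib_left mult_ac)

lemma diag_entry_sum:
  "diag_entry U (conj_diag V (\<lambda>k. \<Sum>b\<in>D. d b k)) i = (\<Sum>b\<in>D. diag_entry U (conj_diag V (d b)) i)"
  unfolding diag_entry_conj_diag by (simp add: sum_distrib_left sum.swap[of _ D])

lemma diag_entry_const:
  "unitary U \<Longrightarrow> unitary V \<Longrightarrow> diag_entry U (conj_diag V (\<lambda>k. c)) i = c"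
  unfolding diag_entry_conj_diag sum_distrib_right[symmetric]
  by (simp add: unitary_row_sum unitary_mult unitary_cadjoint)

text \<open>Ky Fan's maximum principle: the squared moduli of a unitary matrix, summed over the rows
  in \<open>I\<close>, are weights at most 1 (column sums) of total \<open>card I\<close> (row
  sums).\<close>

lemma diag_entry_sum_le_top:
  assumes U: "unitary U" and V: "unitary V" and d: "\<And>k. 0 \<le> d k"
    and J: "is_top J d" "card I \<le> card J"
  shows "(\<Sum>i\<in>I. diag_entry U (conj_diag V d) i) \<le> sum d J"
proof -
  define W where "W = cadjoint U ** V"
  have W: "unitary W" by (simp add: W_def U V unitary_mult unitary_cadjoint)
  have "(\<Sum>i\<in>I. diag_entry U (conj_diag V d) i)
      = (\<Sum>k\<in>UNIV. (\<Sum>i\<in>I. (cmod (W $ i $ k))\<^sup>2) * d k)"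
    unfolding diag_entry_conj_diag W_def sum_distrib_right by (rule sum.swap)
  also have "\<dots> \<le> sum d J"
  proof (rule top_weights[OF J(1) d])
    show "(\<Sum>i\<in>I. (cmod (W $ i $ k))\<^sup>2) \<le> 1" for k
      using sum_mono2[of UNIV I "\<lambda>i. (cmod (W $ i $ k))\<^sup>2"] unitary_col_sum[OF W, of k] by simp
    have "(\<Sum>k\<in>UNIV. \<Sum>i\<in>I. (cmod (W $ i $ k))\<^sup>2) = (\<Sum>i\<in>I. \<Sum>k\<in>UNIV. (cmod (W $ i $ k))\<^sup>2)"
      by (rule sum.swap)
    also have "\<dots> = card I" by (simp add: unitary_row_sum[OF W])
    finally show "(\<Sum>k\<in>UNIV. \<Sum>i\<in>I. (cmod (W $ i $ k))\<^sup>2) \<le> real (card J)"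
      using J(2) by simp
  qed (simp add: sum_nonneg)
  finally show ?thesis .
qed

section \<open>Diagonals of range projections\<close>

lemma norm_vec_sq: "(norm (x :: complex^'n))\<^sup>2 = (\<Sum>i\<in>UNIV. (cmod (x $ i))\<^sup>2)"
  by (simp add: norm_vec_def L2_set_def sum_nonneg)

lemma norm_cip: "cmod (cip x y) \<le> norm x * norm y"
proof -
  have "cmod (cip x y) \<le> (\<Sum>i\<in>UNIV. \<bar>cmod (x $ i)\<bar> * \<bar>cmod (y $ i)\<bar>)"
    unfolding cip_def by (rule order_trans[OF norm_sum]) (simp add: norm_mult)
  also have "\<dots> \<le> norm x * norm y"
    unfolding norm_vec_def by (rule L2_set_mult_ineq)
  finally show ?thesis .
qed

text \<open>With \<open>D\<close> the pseudo-inverse of \<open>rdiag z\<close> (note \<open>1 / 0 = 0\<close>), the right-hand side is the diagonal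
  of \<open>M D M = C C*\<close> for the contraction \<open>C = M D\<^sup>1\<^sup>/\<^sup>2\<close>, whose range lies in that of \<open>P\<close>.\<close>

lemma projection_diag_ge:
  fixes M K P :: "complex^'n^'n"
  assumes M: "cadjoint M = M" and K: "cadjoint K = K" and MK: "M ** M + K ** K = rdiag z"
    and P: "cadjoint P = P" "P ** P = P" "P ** M = M" and z: "\<And>i. 0 \<le> z i"
  shows "(\<Sum>j\<in>UNIV. (cmod (M $ i $ j))\<^sup>2 / z j) \<le> Re (P $ i $ i)"
proof -
  define r where "r = (\<Sum>j\<in>UNIV. (cmod (M $ i $ j))\<^sup>2 / z j)"
  \<comment> \<open>Column \<open>i\<close> of D M with D as above, so that entry \<open>i\<close>
    of \<open>M *v t\<close> is \<open>r\<close>. As \<open>P\<close> fixes \<open>M *v t\<close>,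
    Cauchy-Schwarz with row \<open>i\<close> of \<open>P\<close> applies.\<close>
  define t where "t = (\<chi> j. cnj (M $ i $ j) / of_real (z j))"
  have Mh: "cnj (M $ a $ b) = M $ b $ a" for a b
    using M by (metis cadjoint_nth)
  have r0: "0 \<le> r" using z by (simp add: r_def sum_nonneg)
  have "(M *v t) $ i = (\<Sum>j\<in>UNIV. M $ i $ j * cnj (M $ i $ j) / of_real (z j))"
    by (simp add: matrix_vector_mult_def t_def)
  also have "\<dots> = of_real r"
    unfolding r_def by (simp add: complex_norm_square del: of_real_power)
  finally have Mt: "(M *v t) $ i = of_real r" .
  have "P *v (M *v t) = M *v t"
    by (simp add: matrix_vector_mul_assoc P)
  then have "of_real r = (P *v (M *v t)) $ i" using Mt by simp
  also have "\<dots> = cip (\<chi> j. cnj (P $ i $ j)) (M *v t)"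
    by (simp add: cip_def matrix_vector_mult_def[of P])
  finally have "cmod (of_real r) \<le> norm (\<chi> j. cnj (P $ i $ j)) * norm (M *v t)"
    by (metis norm_cip)
  then have "r\<^sup>2 \<le> (norm (\<chi> j. cnj (P $ i $ j)))\<^sup>2 * (norm (M *v t))\<^sup>2"
    using r0 power_mono[of r "norm (\<chi> j. cnj (P $ i $ j)) * norm (M *v t)" 2]
    by (simp add: power_mult_distrib)
  moreover have Pii: "(norm (\<chi> j. cnj (P $ i $ j)))\<^sup>2 = Re (P $ i $ i)"
  proof -
    have "P $ i $ i = (P ** cadjoint P) $ i $ i" by (simp add: P)
    also have "\<dots> = of_real (\<Sum>j\<in>UNIV. (cmod (P $ i $ j))\<^sup>2)"
      unfolding of_real_sum complex_norm_square by (simp add: matrix_matrix_mult_def cadjoint_nth)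
    finally show ?thesis by (simp add: norm_vec_sq)
  qed
  \<comment> \<open>\<open>M ** M\<close> is dominated by \<open>rdiag z\<close>, since
    \<open>K ** K\<close> contributes a square; the form of \<open>rdiag z\<close> at
    \<open>t\<close> is \<open>r\<close>.\<close>
  moreover have "(norm (M *v t))\<^sup>2 \<le> r"
  proof -
    have nn: "of_real ((norm (X *v t))\<^sup>2) = cip t ((X ** X) *v t)" if "cadjoint X = X" for X
      unfolding cip_self[symmetric] by (metis cip_adjoint matrix_vector_mul_assoc that)
    have "of_real ((norm (M *v t))\<^sup>2 + (norm (K *v t))\<^sup>2) = cip t (rdiag z *v t)"
      unfolding MK[symmetric] of_real_add nn[OF M] nn[OF K]
      by (simp add: cip_simps matrix_vector_mult_add_rdistrib)
    also have "\<dots> = of_real r"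
    proof -
      have "cnj (t $ j) * (of_real (z j) * t $ j) = of_real ((cmod (M $ i $ j))\<^sup>2 / z j)" for j
        by (cases "z j = 0") (simp_all add: t_def complex_norm_square del: of_real_power)
      moreover have "(rdiag z *v t) $ j = of_real (z j) * t $ j" for j
        by (simp add: rdiag_def matrix_vector_mult_def if_distrib[of "\<lambda>x. x * _"] cong: if_cong)
      ultimately show ?thesis by (simp add: cip_def r_def)
    qed
    finally have "(norm (M *v t))\<^sup>2 + (norm (K *v t))\<^sup>2 = r"
      using of_real_eq_iff by blast
    then show ?thesis by (smt (verit) zero_le_power2)
  qed
  ultimately have "r\<^sup>2 \<le> Re (P $ i $ i) * r"
    by (smt (verit) mult_left_mono zero_le_power2)
  moreover have "0 \<le> Re (P $ i $ i)"
    unfolding Pii[symmetric] by simp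
  ultimately have "r \<le> Re (P $ i $ i)"
    using r0 by (cases "r = 0") (auto simp: power2_eq_square)
  then show ?thesis by (simp add: r_def)
qed

text \<open>Dividing by \<open>z i\<close> instead of \<open>z j\<close> gives exactly 1 for each
  row in \<open>I\<close>. The exchange changes nothing over pairs inside \<open>I\<close>, by
  symmetry, and for \<open>j\<close> outside \<open>I\<close> the divisor only decreases.\<close>

lemma sum_ratio_top_ge:
  fixes m :: "'n::finite \<Rightarrow> 'n \<Rightarrow> real"
  assumes sym: "\<And>i j. m i j = m j i" and m: "\<And>i j. 0 \<le> m i j" and z: "\<And>i. (\<Sum>j\<in>UNIV. m i j) = z i"
    and I: "is_top I z" "\<And>i. i \<in> I \<Longrightarrow> 0 < z i"
  shows "card I \<le> (\<Sum>i\<in>I. \<Sum>j\<in>UNIV. m i j / z j)"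
proof -
  have split: "(\<Sum>j\<in>UNIV. h j) = (\<Sum>j\<in>I. h j) + (\<Sum>j\<in>-I. h j)" for h :: "'n \<Rightarrow> real"
    by (metis Compl_eq_Diff_UNIV add.commute finite subset_UNIV sum.subset_diff)
  have "real (card I) = (\<Sum>i\<in>I. (\<Sum>j\<in>UNIV. m i j) / z i)"
  proof -
    have "(\<Sum>i\<in>I. (\<Sum>j\<in>UNIV. m i j) / z i) = (\<Sum>i\<in>I. 1)"
      using I(2) by (intro sum.cong) (force simp: z)+
    then show ?thesis by simp
  qed
  also have "\<dots> = (\<Sum>i\<in>I. \<Sum>j\<in>I. m i j / z i) + (\<Sum>i\<in>I. \<Sum>j\<in>-I. m i j / z i)"
    by (simp only: split sum.distrib add_divide_distrib sum_divide_distrib)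
  also have "(\<Sum>i\<in>I. \<Sum>j\<in>I. m i j / z i) = (\<Sum>i\<in>I. \<Sum>j\<in>I. m i j / z j)"
    by (subst sum.swap) (simp add: sym)
  also have "(\<Sum>i\<in>I. \<Sum>j\<in>-I. m i j / z i) \<le> (\<Sum>i\<in>I. \<Sum>j\<in>-I. m i j / z j)"
  proof (intro sum_mono)
    fix i j assume i: "i \<in> I" and j: "j \<in> -I"
    have "m j i \<le> z j"
      unfolding z[symmetric] using m by (intro member_le_sum) auto
    then have "0 \<le> z j" using m[of j i] by simp
    \<comment> \<open>If \<open>z j = 0\<close>, the default quotient is harmless:
      \<open>m i j\<close> is bounded by \<open>z j\<close>, hence 0.\<close>
    show "m i j / z i \<le> m i j / z j"
    proof (cases "z j = 0")
      case True
      then have "m i j = 0" using \<open>m j i \<le> z j\<close> m[of i j] sym[of i j] by simp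
      then show ?thesis by simp
    next
      case False
      then show ?thesis using I i j m \<open>0 \<le> z j\<close> by (intro divide_left_mono) (auto simp: is_top_def)
    qed
  qed
  also have "(\<Sum>i\<in>I. \<Sum>j\<in>I. m i j / z j) + (\<Sum>i\<in>I. \<Sum>j\<in>-I. m i j / z j) = (\<Sum>i\<in>I. \<Sum>j\<in>UNIV. m i j / z j)"
    by (simp add: split sum.distrib)
  finally show ?thesis by simp
qed

text \<open>The inequality tr (E (P + Q)) \<ge> tr E in an eigenbasis of the sum. The squared moduli
  of the entries of both square roots add up to a symmetric matrix with row sums
  \<open>z\<close>.\<close>

lemma support_projections_diag:
  fixes V W :: "complex^'n^'n"
  assumes V: "unitary V" and W: "unitary W" and x: "\<And>k. 0 \<le> x k" and y: "\<And>k. 0 \<le> y k"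
    and eq: "conj_diag V x + conj_diag W y = rdiag z"
    and I: "is_top I z" "\<And>i. i \<in> I \<Longrightarrow> 0 < z i"
  shows "card I \<le> (\<Sum>i\<in>I. Re (conj_diag V (\<lambda>k. of_bool (0 < x k)) $ i $ i)
                       + Re (conj_diag W (\<lambda>k. of_bool (0 < y k)) $ i $ i))"
proof -
  define M where "M = conj_diag V (\<lambda>k. sqrt (x k))"
  define K where "K = conj_diag W (\<lambda>k. sqrt (y k))"
  have MK: "M ** M + K ** K = rdiag z"
    using eq x y by (simp add: M_def K_def conj_diag_mult V W)
  then have KM: "K ** K + M ** M = rdiag z"
    by (simp add: add.commute)
  have adj: "cadjoint M = M" "cadjoint K = K"
    by (simp_all add: M_def K_def cadjoint_conj_diag)
  define m where "m i j = (cmod (M $ i $ j))\<^sup>2 + (cmod (K $ i $ j))\<^sup>2" for i j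
  have sym: "m i j = m j i" for i j
    unfolding m_def by (metis adj cadjoint_nth complex_mod_cnj)
  have mz: "(\<Sum>j\<in>UNIV. m i j) = z i" for i
  proof -
    have "of_real (\<Sum>j\<in>UNIV. m i j) = (M ** cadjoint M + K ** cadjoint K) $ i $ i"
      unfolding m_def of_real_sum of_real_add complex_norm_square
      by (simp add: matrix_matrix_mult_def cadjoint_nth sum.distrib)
    also have "\<dots> = of_real (z i)" by (simp add: adj MK) (simp add: rdiag_def)
    finally show ?thesis using of_real_eq_iff by blast
  qed
  have z: "0 \<le> z i" for i
    unfolding mz[symmetric] m_def by (intro sum_nonneg) simp
  have "card I \<le> (\<Sum>i\<in>I. \<Sum>j\<in>UNIV. m i j / z j)"
    by (rule sum_ratio_top_ge[OF sym _ mz I]) (simp add: m_def)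
  also have "\<dots> = (\<Sum>i\<in>I. (\<Sum>j\<in>UNIV. (cmod (M $ i $ j))\<^sup>2 / z j) + (\<Sum>j\<in>UNIV. (cmod (K $ i $ j))\<^sup>2 / z j))"
    by (simp add: m_def add_divide_distrib sum.distrib)
  also have "\<dots> \<le> (\<Sum>i\<in>I. Re (conj_diag V (\<lambda>k. of_bool (0 < x k)) $ i $ i)
                       + Re (conj_diag W (\<lambda>k. of_bool (0 < y k)) $ i $ i))"
  proof (intro sum_mono add_mono)
    \<comment> \<open>Says that the range projection absorbs the square root, the hypothesis
      \<open>P ** M = M\<close>.\<close>
    have *: "of_bool (0 < a) * sqrt a = sqrt a" if "0 \<le> a" for a :: real
      using that by (cases "a = 0") simp_all
    show "(\<Sum>j\<in>UNIV. (cmod (M $ i $ j))\<^sup>2 / z j) \<le> Re (conj_diag V (\<lambda>k. of_bool (0 < x k)) $ i $ i)" for i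
      by (rule projection_diag_ge[OF adj MK _ _ _ z])
        (simp_all only: cadjoint_conj_diag conj_diag_mult[OF V] M_def * x of_bool_conj[symmetric] conj_absorb)
    show "(\<Sum>j\<in>UNIV. (cmod (K $ i $ j))\<^sup>2 / z j) \<le> Re (conj_diag W (\<lambda>k. of_bool (0 < y k)) $ i $ i)" for i
      by (rule projection_diag_ge[OF adj(2,1) KM _ _ _ z])
        (simp_all only: cadjoint_conj_diag conj_diag_mult[OF W] K_def * y of_bool_conj[symmetric] conj_absorb)
  qed
  finally show ?thesis .
qed

section \<open>Spectra of sums of Hermitian matrices\<close>

lemma cadjoint_add: "cadjoint (H + K) = cadjoint H + cadjoint K"
  by (simp add: vec_eq_iff cadjoint_nth)

lemma spectral_sum:
  "\<exists>R s. unitary R \<and> conj_diag V d + conj_diag W e = conj_diag R s"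
proof -
  have "hermitian (conj_diag V d + conj_diag W e)"
    by (simp add: hermitian_def cadjoint_add cadjoint_conj_diag)
  then show ?thesis
    unfolding conj_diag_def by (rule hermitian_diagonalizable)
qed

lemma diag_entry_nonneg:
  "(\<And>k. 0 \<le> d k) \<Longrightarrow> 0 \<le> diag_entry U (conj_diag V d) i"
  unfolding diag_entry_conj_diag by (intro sum_nonneg) simp

lemma eigenvalue_sum_nonneg:
  assumes "unitary U" "\<And>k. 0 \<le> d k" "\<And>k. 0 \<le> e k"
    and "conj_diag V d + conj_diag W e = conj_diag U z"
  shows "0 \<le> z i"
  using diag_entry_self[OF assms(1), of z i] diag_entry_nonneg[where d=d and V=V and U=U and i=i, OF assms(2)]
    diag_entry_nonneg[where d=e and V=W and U=U and i=i, OF assms(3)]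
  unfolding assms(4)[symmetric] diag_entry_add by simp

subsection \<open>Majorization for convex functions of matrices\<close>

text \<open>Add \<open>b * card I1\<close> to both sides. On the left the range projections pay for
  it; on the right it is the cost of passing from \<open>\<sigma>\<close> to
  \<open>max 0 (\<sigma> k - b)\<close>.\<close>

lemma angle_weakly_majorized:
  assumes V: "unitary V" and W: "unitary W" and R: "unitary R" and U: "unitary U"
    and \<alpha>: "\<And>k. 0 \<le> \<alpha> k" and \<beta>: "\<And>k. 0 \<le> \<beta> k" and b: "0 \<le> b"
    and S: "conj_diag V \<alpha> + conj_diag W \<beta> = conj_diag R \<sigma>"
    and Z: "conj_diag V (\<lambda>k. max 0 (\<alpha> k - b)) + conj_diag W (\<lambda>k. max 0 (\<beta> k - b)) = conj_diag U z"
  shows "weakly_majorized z (\<lambda>k. max 0 (\<sigma> k - b))"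
  unfolding weakly_majorized_def
proof
  fix I :: "'a set"
  define x y where "x k = max 0 (\<alpha> k - b)" and "y k = max 0 (\<beta> k - b)" for k
  have Z': "conj_diag V x + conj_diag W y = conj_diag U z"
    using Z by (simp add: x_def[abs_def] y_def[abs_def])
  have z: "0 \<le> z i" for i
    by (rule eigenvalue_sum_nonneg[OF U _ _ Z']) (simp_all add: x_def y_def)
  obtain I0 where I0: "is_top I0 z" "card I0 = card I" using exists_top by blast
  \<comment> \<open>The trace bound needs positive eigenvalues; dropping zeros preserves both the
    sum and the top property.\<close>
  define I1 where "I1 = {i \<in> I0. 0 < z i}"
  have I1: "is_top I1 z"
    using I0(1) z by (auto simp: is_top_def I1_def not_less intro: order_trans)
  have "cadjoint U ** (conj_diag V x + conj_diag W y) ** U = conj_diag (cadjoint U ** V) x + conj_diag (cadjoint U ** W) y"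
  proof -
    have "cadjoint U ** (H + K) ** U = cadjoint U ** H ** U + cadjoint U ** K ** U" for H K
      by (simp add: vec_eq_iff matrix_matrix_mult_def algebra_simps sum.distrib)
    then show ?thesis using conj_diag_conj[of "cadjoint U"] by simp
  qed
  then have "conj_diag (cadjoint U ** V) x + conj_diag (cadjoint U ** W) y = rdiag z"
    unfolding Z' using conj_diag_cadjoint[OF U] by metis
  moreover have "Re (conj_diag (cadjoint U ** X) d $ i $ i) = diag_entry U (conj_diag X d) i" for X d i
    using conj_diag_conj[of "cadjoint U" X d] by (simp add: diag_entry_def)
  ultimately have card: "card I1 \<le> (\<Sum>i\<in>I1. diag_entry U (conj_diag V (\<lambda>k. of_bool (0 < x k))) i
                       + diag_entry U (conj_diag W (\<lambda>k. of_bool (0 < y k))) i)"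
    using support_projections_diag[of "cadjoint U ** V" "cadjoint U ** W" x y z I1] I1
    by (simp add: V W U unitary_mult unitary_cadjoint x_def y_def) (simp add: I1_def)
  have "sum z I \<le> sum z I0"
    using I0 z by (intro top_sum) auto
  also have "\<dots> = sum z I1"
    unfolding I1_def sum.inter_filter[OF finite] using z by (intro sum.cong) (auto simp: order_le_less)
  also have "\<dots> \<le> (\<Sum>i\<in>I1. diag_entry U (conj_diag R (\<lambda>k. max 0 (\<sigma> k - b))) i)"
  proof -
    \<comment> \<open>Lifts \<open>max 0 (s - b) + b * of_bool (b < s) \<le> s\<close>, valid for
      \<open>s \<ge> 0\<close>, to matrices.\<close>
    have up: "diag_entry U (conj_diag X (\<lambda>k. max 0 (d k - b))) i
        + b * diag_entry U (conj_diag X (\<lambda>k. of_bool (0 < max 0 (d k - b)))) i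
        \<le> diag_entry U (conj_diag X d) i" if "\<And>k. 0 \<le> d k" for X d i
    proof -
      have "diag_entry U (conj_diag X (\<lambda>k. max 0 (d k - b) + b * of_bool (0 < max 0 (d k - b)))) i
          \<le> diag_entry U (conj_diag X d) i"
        using that by (intro diag_entry_mono) auto
      then show ?thesis by (simp only: conj_diag_add[symmetric] diag_entry_add diag_entry_scale)
    qed
    have "sum z I1 + b * card I1 \<le> (\<Sum>i\<in>I1. diag_entry U (conj_diag V x + conj_diag W y) i)
        + b * (\<Sum>i\<in>I1. diag_entry U (conj_diag V (\<lambda>k. of_bool (0 < x k))) i
                       + diag_entry U (conj_diag W (\<lambda>k. of_bool (0 < y k))) i)"
      using mult_left_mono[OF card b] by (simp add: Z' diag_entry_self[OF U])
    also have "\<dots> \<le> (\<Sum>i\<in>I1. diag_entry U (conj_diag V \<alpha> + conj_diag W \<beta>) i)"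
      unfolding sum_distrib_left sum.distrib[symmetric]
    proof (rule sum_mono)
      fix i
      show "diag_entry U (conj_diag V x + conj_diag W y) i
        + b * (diag_entry U (conj_diag V (\<lambda>k. of_bool (0 < x k))) i
                       + diag_entry U (conj_diag W (\<lambda>k. of_bool (0 < y k))) i)
        \<le> diag_entry U (conj_diag V \<alpha> + conj_diag W \<beta>) i"
        using up[of \<alpha> V i, OF \<alpha>] up[of \<beta> W i, OF \<beta>] unfolding x_def y_def diag_entry_add
        by (simp add: algebra_simps)
    qed
    also have "\<dots> \<le> (\<Sum>i\<in>I1. diag_entry U (conj_diag R (\<lambda>k. max 0 (\<sigma> k - b) + b)) i)"
      unfolding S by (intro sum_mono diag_entry_mono) auto
    also have "\<dots> = (\<Sum>i\<in>I1. diag_entry U (conj_diag R (\<lambda>k. max 0 (\<sigma> k - b))) i) + b * card I1"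
      unfolding conj_diag_add[symmetric] diag_entry_add
      by (simp add: diag_entry_const[OF U R] sum.distrib)
    finally show ?thesis by simp
  qed
  finally have le: "sum z I \<le> (\<Sum>i\<in>I1. diag_entry U (conj_diag R (\<lambda>k. max 0 (\<sigma> k - b))) i)" .
  obtain J where J: "is_top J (\<lambda>k. max 0 (\<sigma> k - b))" "card J = card I" using exists_top by blast
  have "card I1 \<le> card J"
    unfolding J(2) I0(2)[symmetric] by (rule card_mono) (auto simp: I1_def)
  then have "(\<Sum>i\<in>I1. diag_entry U (conj_diag R (\<lambda>k. max 0 (\<sigma> k - b))) i) \<le> (\<Sum>k\<in>J. max 0 (\<sigma> k - b))"
    using J(1) by (intro diag_entry_sum_le_top[OF U R]) auto
  then show "\<exists>J. card J \<le> card I \<and> sum z I \<le> (\<Sum>k\<in>J. max 0 (\<sigma> k - b))"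
    using le J(2) by (intro exI[of _ J]) auto
qed

text \<open>In the fixed basis \<open>U\<close> the eigenvalues \<open>z\<close> are diagonal
  entries, hence additive over the angle functions. One top set of \<open>\<sigma>\<close> serves
  every \<open>b\<close>, so the bounds for single angles add up.\<close>

lemma convex_weakly_majorized:
  fixes \<phi> :: "real \<Rightarrow> real"
  assumes V: "unitary V" and W: "unitary W" and R: "unitary R" and U: "unitary U"
    and \<alpha>: "\<And>k. 0 \<le> \<alpha> k" and \<beta>: "\<And>k. 0 \<le> \<beta> k"
    and S: "conj_diag V \<alpha> + conj_diag W \<beta> = conj_diag R \<sigma>"
    and Z: "conj_diag V (\<phi> \<circ> \<alpha>) + conj_diag W (\<phi> \<circ> \<beta>) = conj_diag U z"
    and D: "\<And>b. b \<in> D \<Longrightarrow> 0 \<le> b" "\<And>b. b \<in> D \<Longrightarrow> 0 \<le> c b"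
    and \<phi>: "\<And>t. t \<in> range \<alpha> \<union> range \<beta> \<union> range \<sigma> \<Longrightarrow> \<phi> t = (\<Sum>b\<in>D. c b * max 0 (t - b))"
  shows "weakly_majorized z (\<phi> \<circ> \<sigma>)"
  unfolding weakly_majorized_def
proof
  fix I :: "'a set"
  obtain J where J: "is_top J \<sigma>" "card J = card I" using exists_top by blast
  have "\<phi> \<circ> \<alpha> = (\<lambda>k. \<Sum>b\<in>D. c b * max 0 (\<alpha> k - b))" "\<phi> \<circ> \<beta> = (\<lambda>k. \<Sum>b\<in>D. c b * max 0 (\<beta> k - b))"
    using \<phi> by auto
  then have "z i = (\<Sum>b\<in>D. c b * diag_entry U (conj_diag V (\<lambda>k. max 0 (\<alpha> k - b))
      + conj_diag W (\<lambda>k. max 0 (\<beta> k - b))) i)" for i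
    using diag_entry_self[OF U, of z i] unfolding Z[symmetric]
    by (simp add: diag_entry_add diag_entry_sum diag_entry_scale sum.distrib algebra_simps)
  then have "sum z I = (\<Sum>b\<in>D. c b * (\<Sum>i\<in>I. diag_entry U (conj_diag V (\<lambda>k. max 0 (\<alpha> k - b))
      + conj_diag W (\<lambda>k. max 0 (\<beta> k - b))) i))"
    by (simp add: sum_distrib_left sum.swap[of _ D])
  also have "\<dots> \<le> (\<Sum>b\<in>D. c b * (\<Sum>k\<in>J. max 0 (\<sigma> k - b)))"
  proof (intro sum_mono mult_left_mono D(2))
    fix b assume b: "b \<in> D"
    \<comment> \<open>\<open>U\<close> need not diagonalize the matrix of a single \<open>b\<close>;
      its diagonal is first bounded by the eigenvalues \<open>d\<close>.\<close>
    obtain Q d where Q: "unitary Q" and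
      e: "conj_diag V (\<lambda>k. max 0 (\<alpha> k - b)) + conj_diag W (\<lambda>k. max 0 (\<beta> k - b)) = conj_diag Q d"
      using spectral_sum by blast
    obtain J' where J': "is_top J' d" "card J' = card I" using exists_top by blast
    have "(\<Sum>i\<in>I. diag_entry U (conj_diag Q d) i) \<le> sum d J'"
      using J' eigenvalue_sum_nonneg[OF Q _ _ e]
      by (intro diag_entry_sum_le_top[OF U Q]) auto
    also have "\<dots> \<le> (\<Sum>k\<in>J. max 0 (\<sigma> k - b))"
      using angle_weakly_majorized[OF V W R Q \<alpha> \<beta> D(1)[OF b] S e] J J' is_top_mono[OF J(1)]
      by (intro weakly_majorized_top) auto
    finally show "(\<Sum>i\<in>I. diag_entry U (conj_diag V (\<lambda>k. max 0 (\<alpha> k - b))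
      + conj_diag W (\<lambda>k. max 0 (\<beta> k - b))) i) \<le> (\<Sum>k\<in>J. max 0 (\<sigma> k - b))"
      unfolding e .
  qed
  also have "\<dots> = (\<Sum>k\<in>J. (\<phi> \<circ> \<sigma>) k)"
    using \<phi> by (simp add: sum_distrib_left sum.swap[of _ D])
  finally show "\<exists>J. card J \<le> card I \<and> sum z I \<le> sum (\<phi> \<circ> \<sigma>) J"
    using J(2) by (intro exI[of _ J]) auto
qed

subsection \<open>Ky Fan dominance\<close>

text \<open>Conjugation by a permutation matrix permutes the entries. The signs multiply on the left
  only, since conjugation by \<open>rdiag s\<close> would cancel them.\<close>

lemma unitarily_invariant_signed_perm:
  fixes y :: "'n::finite \<Rightarrow> real"
  assumes N: "unitarily_invariant_norm N" and p: "bij p" and s: "\<And>i. s i = 1 \<or> s i = (-1::real)"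
  shows "N (rdiag (\<lambda>i. s i * y (p i))) = N (rdiag y)"
proof -
  define Q :: "complex^'n^'n" where "Q = (\<chi> i k. if k = p i then 1 else 0)"
  have p': "p i = p j \<longleftrightarrow> i = j" for i j using p by (meson bij_def inj_eq)
  have "Q ** cadjoint Q = mat 1"
    by (simp add: vec_eq_iff matrix_matrix_mult_def cadjoint_nth Q_def mat_def p' if_distrib[of "\<lambda>x. x * _"] cong: if_cong)
  then have Q: "unitary Q"
    by (simp add: unitary_def matrix_left_right_inverse[of "cadjoint Q" Q])
  have "unitary (rdiag s)"
  proof -
    have "cadjoint (rdiag s) = rdiag s"
      by (simp add: vec_eq_iff cadjoint_nth) (simp add: rdiag_def)
    moreover have "rdiag s ** rdiag s = mat 1"
      unfolding vec_eq_iff rdiag_mult_left using s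
      by (auto simp: rdiag_def mat_def) (metis mult_cancel_left1 mult_minus1_right of_real_1 of_real_minus minus_minus)+
    ultimately show ?thesis by (simp add: unitary_def)
  qed
  then have "N (rdiag y) = N (rdiag s ** Q ** rdiag y ** cadjoint Q)"
    using N Q unfolding unitarily_invariant_norm_def by (metis unitary_mult unitary_cadjoint)
  also have "rdiag s ** Q ** rdiag y ** cadjoint Q = rdiag (\<lambda>i. s i * y (p i))"
  proof -
    have "rdiag s ** Q ** rdiag y ** cadjoint Q = rdiag s ** conj_diag Q y"
      by (simp add: conj_diag_def matrix_mul_assoc)
    also have "\<dots> = rdiag (\<lambda>i. s i * y (p i))"
      unfolding vec_eq_iff rdiag_mult_left conj_diag_nth
      by (simp add: Q_def rdiag_def p' if_distrib[of "\<lambda>x. x * _"] cong: if_cong)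
    finally show ?thesis .
  qed
  finally show ?thesis by simp
qed

text \<open>Hahn--Banach: a functional separating \<open>x\<close> from the signed permutations of \<open>y\<close> would contradict
  the rearrangement inequality, so \<open>x\<close> is a convex combination of them.\<close>

lemma weakly_majorized_norm_le:
  fixes x y :: "'n::finite \<Rightarrow> real"
  assumes N: "unitarily_invariant_norm N" and wm: "weakly_majorized x y"
    and x: "\<And>i. 0 \<le> x i" and y: "\<And>i. 0 \<le> y i"
  shows "N (rdiag x) \<le> N (rdiag y)"
proof -
  define P where "P = (\<lambda>(s, p). (\<chi> i. (if s i then 1 else - 1) * y (p i)) :: real^'n) ` (UNIV \<times> {p. bij p})"
  have finP: "finite P" unfolding P_def by (intro finite_imageI) auto
  have "(\<chi> i. x i) \<in> convex hull P"
  proof (rule ccontr)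
    assume "(\<chi> i. x i) \<notin> convex hull P"
    moreover have "closed (convex hull P)"
      by (simp add: compact_convex_hull compact_imp_closed finP finite_imp_compact)
    ultimately obtain a b where ab: "inner a (\<chi> i. x i) < b" "\<And>v. v \<in> convex hull P \<Longrightarrow> b < inner a v"
      using separating_hyperplane_closed_point[of "convex hull P" "\<chi> i. x i"] by (auto simp: convex_convex_hull)
    obtain p where p: "bij p" "(\<Sum>i\<in>UNIV. \<bar>a $ i\<bar> * x i) \<le> (\<Sum>i\<in>UNIV. \<bar>a $ i\<bar> * y (p i))"
      using weakly_majorized_rearrange[OF wm y, of "\<lambda>i. \<bar>a $ i\<bar>"] by auto
    \<comment> \<open>Signs opposite to those of \<open>a\<close> turn \<open>inner a v\<close> into
      minus the rearranged sum with weights \<open>\<bar>a $ i\<bar>\<close>, so it cannot exceed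
      the value at \<open>x\<close>.\<close>
    define v where "v = (\<chi> i. (if a $ i < 0 then 1 else - 1) * y (p i))"
    have "v \<in> P" using p(1) by (force simp: P_def v_def)
    then have "b < inner a v" by (intro ab(2) hull_inc)
    also have "inner a v = - (\<Sum>i\<in>UNIV. \<bar>a $ i\<bar> * y (p i))"
      unfolding inner_vec_def sum_negf[symmetric] by (rule sum.cong) (auto simp: v_def)
    also have "\<dots> \<le> - (\<Sum>i\<in>UNIV. \<bar>a $ i\<bar> * x i)" using p(2) by simp
    also have "\<dots> \<le> inner a (\<chi> i. x i)"
      unfolding inner_vec_def sum_negf[symmetric]
    proof (rule sum_mono)
      fix i
      have "- \<bar>a $ i\<bar> * x i \<le> a $ i * x i" using x by (intro mult_right_mono) auto
      then show "- (\<bar>a $ i\<bar> * x i) \<le> inner (a $ i) ((\<chi> i. x i) $ i)" by simp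
    qed
    finally show False using ab(1) by simp
  qed
  \<comment> \<open>A sublevel set of the norm: being convex and containing \<open>P\<close>, it
    contains the hull.\<close>
  moreover have "convex {v :: real^'n. N (rdiag (($) v)) \<le> N (rdiag y)}"
  proof (rule convexI)
    fix v w :: "real^'n" and u t :: real
    assume vw: "v \<in> {v. N (rdiag (($) v)) \<le> N (rdiag y)}" "w \<in> {v. N (rdiag (($) v)) \<le> N (rdiag y)}"
      and ut: "0 \<le> u" "0 \<le> t" "u + t = 1"
    have hom: "N (\<chi> i j. c * A $ i $ j) = cmod c * N A" and tri: "N (A + B) \<le> N A + N B" for c A B
      using N unfolding unitarily_invariant_norm_def matrix_norm_def by blast+
    have "rdiag (($) (u *\<^sub>R v + t *\<^sub>R w)) =
        (\<chi> i j. of_real u * rdiag (($) v) $ i $ j) + (\<chi> i j. of_real t * rdiag (($) w) $ i $ j)"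
      by (simp add: vec_eq_iff rdiag_def)
    then have "N (rdiag (($) (u *\<^sub>R v + t *\<^sub>R w))) \<le> u * N (rdiag (($) v)) + t * N (rdiag (($) w))"
      using tri hom ut by (metis norm_of_real abs_of_nonneg)
    also have "\<dots> \<le> u * N (rdiag y) + t * N (rdiag y)"
      using vw ut by (intro add_mono mult_left_mono) auto
    also have "\<dots> = N (rdiag y)" using ut(3) by (simp flip: distrib_right)
    finally show "u *\<^sub>R v + t *\<^sub>R w \<in> {v. N (rdiag (($) v)) \<le> N (rdiag y)}" by simp
  qed
  moreover have "P \<subseteq> {v. N (rdiag (($) v)) \<le> N (rdiag y)}"
  proof
    fix v assume "v \<in> P"
    then obtain s p where v: "bij p" "v = (\<chi> i. (if s i then 1 else - 1) * y (p i))"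
      by (auto simp: P_def)
    have "($) v = (\<lambda>i. (if s i then 1 else - 1) * y (p i))" by (simp add: v(2) fun_eq_iff)
    then show "v \<in> {v. N (rdiag (($) v)) \<le> N (rdiag y)}"
      using unitarily_invariant_signed_perm[OF N v(1), of "\<lambda>i. if s i then 1 else - 1" y] by simp
  qed
  ultimately have "(\<chi> i. x i) \<in> {v. N (rdiag (($) v)) \<le> N (rdiag y)}"
    using hull_minimal[of P "{v. N (rdiag (($) v)) \<le> N (rdiag y)}" convex] by blast
  moreover have "($) (\<chi> i. x i) = x" by (simp add: fun_eq_iff)
  ultimately show ?thesis by simp
qed

lemma unitarily_invariant_conj_diag:
  "unitarily_invariant_norm N \<Longrightarrow> unitary U \<Longrightarrow> N (conj_diag U d) = N (rdiag d)"
  unfolding unitarily_invariant_norm_def conj_diag_def using unitary_cadjoint by blast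

subsection \<open>Convex functions on finite sets\<close>

text \<open>Points are added from left to right. The kink at the previous maximum \<open>s\<close>
  is invisible on \<open>D\<close>, so its coefficient is free to match the value at the new point;
  the slope condition makes it nonnegative.\<close>

lemma angle_decomposition:
  fixes \<phi> :: "real \<Rightarrow> real"
  assumes "finite D" "0 \<in> D" "\<And>t. t \<in> D \<Longrightarrow> 0 \<le> t" "\<phi> 0 = 0" "\<And>t. t \<in> D \<Longrightarrow> 0 \<le> \<phi> t"
    and "\<And>p q r. p \<in> D \<Longrightarrow> q \<in> D \<Longrightarrow> r \<in> D \<Longrightarrow> p < q \<Longrightarrow> q < r \<Longrightarrow>
           (\<phi> q - \<phi> p) * (r - q) \<le> (\<phi> r - \<phi> q) * (q - p)"
  shows "\<exists>c. (\<forall>b\<in>D. 0 \<le> c b) \<and> (\<forall>t\<in>D. \<phi> t = (\<Sum>b\<in>D. c b * max 0 (t - b)))"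
  using assms
proof (induction D rule: finite_linorder_max_induct)
  case (insert t D)
  note slope = insert.prems(5)
  show ?case
  proof (cases "0 \<in> D")
    case False
    then have "t = 0" using insert.prems(1) by auto
    then have "D = {}" using insert.hyps(2) insert.prems(2) by force
    then show ?thesis using \<open>t = 0\<close> insert.prems(3) by (intro exI[of _ "\<lambda>_. 0"]) simp
  next
    case True
    have "\<exists>c. (\<forall>b\<in>D. 0 \<le> c b) \<and> (\<forall>t\<in>D. \<phi> t = (\<Sum>b\<in>D. c b * max 0 (t - b)))"
      using insert.prems True by (intro insert.IH) auto
    then obtain c where c: "\<And>b. b \<in> D \<Longrightarrow> 0 \<le> c b" "\<And>t. t \<in> D \<Longrightarrow> \<phi> t = (\<Sum>b\<in>D. c b * max 0 (t - b))"
      by blast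
    have fin: "finite D" by fact
    define s where "s = Max D"
    have s: "s \<in> D" "\<And>u. u \<in> D \<Longrightarrow> u \<le> s"
      unfolding s_def using fin True by (auto intro: Max_in)
    then have st: "s < t" "t \<notin> D" using insert.hyps(2) by auto
    define E where "E = D - {s}"
    have D: "D = insert s E" "s \<notin> E" "finite E" using s fin by (auto simp: E_def)
    define L where "L u = (\<Sum>b\<in>E. c b * (u - b))" for u
    have \<phi>E: "\<phi> u = (\<Sum>b\<in>E. c b * max 0 (u - b))" if "u \<in> D" for u
      using c(2)[OF that] s(2)[OF that] D by simp
    have L: "\<phi> u = L u" if "u \<in> D" "\<And>b. b \<in> E \<Longrightarrow> b \<le> u" for u
      unfolding \<phi>E[OF that(1)] L_def using that(2) by (intro sum.cong) auto
    have affine: "L u = (\<Sum>b\<in>E. c b) * u - (\<Sum>b\<in>E. c b * b)" for u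
      by (simp add: L_def algebra_simps sum_subtractf sum_distrib_left)
    have Ls: "\<phi> s = L s" using s D by (intro L) auto
    \<comment> \<open>Convexity keeps \<open>\<phi> t\<close> above the continued chord through the
      last two points \<open>s'\<close> and \<open>s\<close> of \<open>D\<close>. If
      \<open>E\<close> is empty, \<open>L\<close> is 0 and \<open>\<phi> t\<close> is
      nonnegative.\<close>
    have Lt: "L t \<le> \<phi> t"
    proof (cases "E = {}")
      case True
      then show ?thesis using insert.prems(4) by (simp add: L_def)
    next
      case False
      define s' where "s' = Max E"
      have s': "s' \<in> E" "\<And>b. b \<in> E \<Longrightarrow> b \<le> s'"
        unfolding s'_def using False D by (auto intro: Max_in)
      have "s' \<noteq> s" "s' \<le> s" using D s' s(2)[of s'] by auto
      then have "s' < s" by simp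
      have "\<phi> s' = L s'" using s' D by (intro L) auto
      then have "(L s - L s') * (t - s) \<le> (\<phi> t - L s) * (s - s')"
        using slope[of s' s t] s' s D \<open>s' < s\<close> st Ls by simp
      moreover have "(L s - L s') * (t - s) = (L t - L s) * (s - s')"
        by (simp add: affine algebra_simps)
      ultimately show ?thesis using \<open>s' < s\<close> by simp
    qed
    define e where "e = (\<phi> t - L t) / (t - s)"
    \<comment> \<open>The kink at \<open>t\<close> has no effect up to \<open>t\<close>, so 0 will
      do there.\<close>
    define c' where "c' b = (if b = s then e else if b = t then 0 else c b)" for b
    have "0 \<le> e" using Lt st by (simp add: e_def)
    have c'sum: "(\<Sum>b\<in>insert t D. c' b * max 0 (u - b)) = e * max 0 (u - s) + (\<Sum>b\<in>E. c b * max 0 (u - b))" for u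
    proof -
      have "(\<Sum>b\<in>E. c' b * max 0 (u - b)) = (\<Sum>b\<in>E. c b * max 0 (u - b))"
        using D st by (intro sum.cong) (auto simp: c'_def)
      then show ?thesis using D st by (auto simp: c'_def)
    qed
    have "\<phi> u = (\<Sum>b\<in>insert t D. c' b * max 0 (u - b))" if "u \<in> insert t D" for u
    proof (cases "u = t")
      case True
      have "(\<Sum>b\<in>E. c b * max 0 (t - b)) = L t"
        unfolding L_def using D insert.hyps(2) by (intro sum.cong) (auto simp: less_imp_le)
      then show ?thesis unfolding c'sum True using st by (simp add: e_def)
    next
      case False
      then have "u \<in> D" using that by simp
      then show ?thesis unfolding c'sum using \<phi>E s(2) by simp
    qed
    moreover have "0 \<le> c' b" if "b \<in> insert t D" for b
      using that c(1) \<open>0 \<le> e\<close> by (auto simp: c'_def)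
    ultimately show ?thesis by blast
  qed
qed simp

text \<open>Without divisions, arguments and values can trade places when an inverse function is
  treated.\<close>

lemma convex_on_slopes:
  fixes h :: "real \<Rightarrow> real"
  assumes h: "convex_on S h" and S: "is_interval S" "p \<in> S" "r \<in> S" and pqr: "p < q" "q < r"
  shows "(h q - h p) * (r - q) \<le> (h r - h q) * (q - p)"
proof -
  have "{p..r} \<subseteq> S"
    using S unfolding is_interval_1 by (meson atLeastAtMost_iff subsetI)
  then have "convex_on {p..r} h" using h by (metis convex_on_subset convex_real_interval(5))
  then have "h q \<le> (h r - h p) / (r - p) * (q - p) + h p"
    using pqr by (intro convex_onD_Icc') auto
  then have "(h q - h p) * (r - p) \<le> (h r - h p) * (q - p)"
    using pqr by (simp add: field_simps)
  then show ?thesis by (simp add: algebra_simps)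
qed

subsection \<open>Functions of positive semidefinite matrices\<close>

lemma pos_semidef_spectral:
  fixes A :: "complex^'n^'n"
  assumes "pos_semidef A"
  obtains V \<alpha> where "unitary V" "A = conj_diag V \<alpha>" "\<And>k. 0 \<le> \<alpha> k"
proof -
  obtain V \<alpha> where V: "unitary V" "A = conj_diag V \<alpha>"
    using assms hermitian_diagonalizable unfolding pos_semidef_def conj_diag_def by blast
  have "0 \<le> \<alpha> k" for k
  proof -
    have "diag_entry V A k = Re (\<Sum>i\<in>UNIV. cnj (column k V $ i) * (A *v column k V) $ i)"
      unfolding diag_entry_def matrix_mul_assoc[symmetric]
      by (simp add: matrix_matrix_mult_def matrix_vector_mult_def cadjoint_nth column_def)
    then show ?thesis
      using assms diag_entry_self[OF V(1), of \<alpha> k] unfolding V(2)[symmetric] pos_semidef_def by metis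
  qed
  with V that show ?thesis by blast
qed

text \<open>Links a chosen diagonalization to the spectrum; column \<open>i\<close> of
  \<open>U\<close> is the eigenvector.\<close>

lemma conj_diag_eigenvalue:
  assumes "unitary U"
  shows "of_real (d i) \<in> eigenvalues (conj_diag U d)"
proof -
  have "conj_diag U d ** U = U ** rdiag d ** (cadjoint U ** U)"
    by (simp only: conj_diag_def matrix_mul_assoc)
  then have "conj_diag U d ** U = U ** rdiag d"
    using assms by (simp add: unitary_def)
  then have "(conj_diag U d ** U) $ j $ i = U $ j $ i * of_real (d i)" for j
    by (simp add: rdiag_mult_right)
  then have "conj_diag U d *v column i U = of_real (d i) *s column i U"
    by (simp add: vec_eq_iff matrix_vector_mult_def column_def matrix_matrix_mult_def mult.commute)
  moreover have "column i U \<noteq> 0"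
  proof
    assume "column i U = 0"
    then have "U $ j $ i = 0" for j by (simp add: column_def vec_eq_iff)
    then show False using unitary_col_sum[OF assms, of i] by simp
  qed
  ultimately show ?thesis unfolding eigenvalues_def by blast
qed

lemma mat_fun_conj_diag: "unitary U \<Longrightarrow> mat_fun \<phi> (conj_diag U d) = conj_diag U (\<phi> \<circ> d)"
  unfolding conj_diag_def by (rule mat_fun_eq)

theorem theorem4p3:
  fixes A B :: "complex^'n^'n"
    and N :: "complex^'n^'n \<Rightarrow> real"
    and f g :: "real \<Rightarrow> real"
    and J\<^sub>2 J\<^sub>3 :: "real set"
  assumes "pos_semidef A" and "pos_semidef B"
    and "unitarily_invariant_norm N"
    and "g_convex_on {0..} J\<^sub>2 J\<^sub>3 g f"
    and "\<forall>t\<ge>0. 0 \<le> f t"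
    and "0 \<in> J\<^sub>2"
    and "(g \<circ> f) 0 \<le> 0" and "0 \<le> g 0"
    and "eigenvalues (mat_fun (g \<circ> f) A + mat_fun (g \<circ> f) B) \<subseteq> complex_of_real ` g ` J\<^sub>2"
  shows "N (mat_fun f A + mat_fun f B)
           \<le> N (mat_fun (the_inv_into J\<^sub>2 g) (mat_fun (g \<circ> f) A + mat_fun (g \<circ> f) B))
       \<and> N (mat_fun (the_inv_into J\<^sub>2 g) (mat_fun (g \<circ> f) A + mat_fun (g \<circ> f) B))
           \<le> N (mat_fun f (A + B))"
proof -
  note N = assms(3)
  have J2: "is_interval J\<^sub>2" and fJ: "\<And>t. 0 \<le> t \<Longrightarrow> f t \<in> J\<^sub>2" and sm: "strict_mono_on J\<^sub>2 g"
    and conc: "convex_on J\<^sub>2 (\<lambda>x. - g x)" and hconv: "convex_on {0..} (g \<circ> f)"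
    using assms(4) by (auto simp: g_convex_on_def concave_on_def)
  define h where "h = g \<circ> f"
  define k where "k = the_inv_into J\<^sub>2 g"
  have less: "g a < g b \<longleftrightarrow> a < b" if "a \<in> J\<^sub>2" "b \<in> J\<^sub>2" for a b
    by (rule strict_mono_on_less[OF sm that])
  have kg: "k (g a) = a" if "a \<in> J\<^sub>2" for a
    unfolding k_def using that sm by (intro the_inv_into_f_f strict_mono_on_imp_inj_on)
  \<comment> \<open>\<open>g (f 0) \<le> 0 \<le> g 0\<close> and strict monotonicity give
    \<open>f 0 \<le> 0\<close>.\<close>
  have f0: "f 0 = 0"
    using less[OF assms(6) fJ[of 0]] assms(5,7,8) by (force simp: order_le_less)
  have g0: "g 0 = 0" using assms(7,8) f0 by simp
  have h0: "h 0 = 0" by (simp add: h_def f0 g0)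
  have k0: "k 0 = 0" using kg[OF assms(6)] g0 by simp
  have kh: "k (h t) = f t" if "0 \<le> t" for t
    using kg[OF fJ[OF that]] by (simp add: h_def)
  have gpos: "0 \<le> g a \<longleftrightarrow> 0 \<le> a" if "a \<in> J\<^sub>2" for a
    using less[OF that assms(6)] g0 by (simp add: not_less[symmetric])
  have hpos: "0 \<le> h t" if "0 \<le> t" for t
    using gpos[OF fJ[OF that]] assms(5) that by (simp add: h_def)
  have hJ: "h t \<in> g ` J\<^sub>2" if "0 \<le> t" for t
    using fJ[OF that] by (simp add: h_def)
  have kpos: "0 \<le> k y" if "y \<in> g ` J\<^sub>2" "0 \<le> y" for y
    using that gpos kg by auto
  have hslope: "(h q - h p) * (r - q) \<le> (h r - h q) * (q - p)" if "0 \<le> p" "p < q" "q < r" for p q r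
    by (rule convex_on_slopes[OF hconv[folded h_def]]) (use that in \<open>auto simp: is_interval_ci\<close>)
  \<comment> \<open>The slope inequality of \<open>- g\<close> at the preimages, with its factors
    regrouped.\<close>
  have kslope: "(k q - k p) * (r - q) \<le> (k r - k q) * (q - p)"
    if pqr: "p \<in> g ` J\<^sub>2" "q \<in> g ` J\<^sub>2" "r \<in> g ` J\<^sub>2" "p < q" "q < r" for p q r
  proof -
    obtain a b c where abc: "a \<in> J\<^sub>2" "b \<in> J\<^sub>2" "c \<in> J\<^sub>2" "p = g a" "q = g b" "r = g c"
      using pqr by blast
    then have "(- g b - - g a) * (c - b) \<le> (- g c - - g b) * (b - a)"
      using pqr less by (intro convex_on_slopes[OF conc J2]) auto
    then show ?thesis by (simp add: abc kg algebra_simps)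
  qed

  \<comment> \<open>\<open>\<alpha>\<close>, \<open>\<beta>\<close>, \<open>\<sigma>\<close> are the
    spectra of A, B, A + B; below, \<open>x\<close> and \<open>z\<close> are those of h(A) + h(B)
    and f(A) + f(B).\<close>
  obtain V \<alpha> where V: "unitary V" "A = conj_diag V \<alpha>" "\<And>i. 0 \<le> \<alpha> i"
    using pos_semidef_spectral[OF assms(1)] by blast
  obtain W \<beta> where W: "unitary W" "B = conj_diag W \<beta>" "\<And>i. 0 \<le> \<beta> i"
    using pos_semidef_spectral[OF assms(2)] by blast
  obtain R \<sigma> where R: "unitary R" and S: "conj_diag V \<alpha> + conj_diag W \<beta> = conj_diag R \<sigma>"
    using spectral_sum by blast
  have \<sigma>: "0 \<le> \<sigma> i" for i using eigenvalue_sum_nonneg[OF R V(3) W(3) S] .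
  obtain U x where U: "unitary U" and X: "conj_diag V (h \<circ> \<alpha>) + conj_diag W (h \<circ> \<beta>) = conj_diag U x"
    using spectral_sum by blast
  have x: "0 \<le> x i" for i
    using eigenvalue_sum_nonneg[OF U _ _ X] V(3) W(3) hpos by simp
  have xJ: "x i \<in> g ` J\<^sub>2" for i
  proof -
    have "complex_of_real (x i) \<in> complex_of_real ` g ` J\<^sub>2"
      using assms(9) conj_diag_eigenvalue[OF U, of x i]
      unfolding V(2) W(2) h_def[symmetric] mat_fun_conj_diag[OF V(1)] mat_fun_conj_diag[OF W(1)] X by blast
    then show ?thesis by auto
  qed
  obtain Q z where Q: "unitary Q" and Z: "conj_diag V (f \<circ> \<alpha>) + conj_diag W (f \<circ> \<beta>) = conj_diag Q z"
    using spectral_sum by blast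
  have z: "0 \<le> z i" for i
    using eigenvalue_sum_nonneg[OF Q _ _ Z] V(3) W(3) assms(5) by simp

  \<comment> \<open>The finitely many points at which \<open>h\<close> is evaluated; 0 anchors the
    decomposition.\<close>
  define D where "D = insert 0 (range \<alpha> \<union> range \<beta> \<union> range \<sigma>)"
  have D: "\<And>t. t \<in> D \<Longrightarrow> 0 \<le> t" using V(3) W(3) \<sigma> by (auto simp: D_def)
  have "\<exists>c. (\<forall>b\<in>D. 0 \<le> c b) \<and> (\<forall>t\<in>D. h t = (\<Sum>b\<in>D. c b * max 0 (t - b)))"
    by (rule angle_decomposition) (use D h0 hpos hslope in \<open>auto simp: D_def\<close>)
  then obtain c where c: "\<And>b. b \<in> D \<Longrightarrow> 0 \<le> c b" "\<And>t. t \<in> D \<Longrightarrow> h t = (\<Sum>b\<in>D. c b * max 0 (t - b))"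
    by blast
  have xh: "weakly_majorized x (h \<circ> \<sigma>)"
  proof (rule convex_weakly_majorized[where D = D and c = c, OF V(1) W(1) R U V(3) W(3) S X D c(1)])
    show "h t = (\<Sum>b\<in>D. c b * max 0 (t - b))" if "t \<in> range \<alpha> \<union> range \<beta> \<union> range \<sigma>" for t
      by (rule c(2)) (use that in \<open>simp add: D_def\<close>)
  qed

  \<comment> \<open>One decomposition of \<open>k\<close> serves both inequalities: the first uses
    \<open>h \<circ> \<alpha>\<close>, \<open>h \<circ> \<beta>\<close> and \<open>x\<close>, the
    second \<open>x\<close> and \<open>h \<circ> \<sigma>\<close>.\<close>
  define E where "E = insert 0 (range (h \<circ> \<alpha>) \<union> range (h \<circ> \<beta>) \<union> range (h \<circ> \<sigma>) \<union> range x)"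
  have E: "\<And>t. t \<in> E \<Longrightarrow> 0 \<le> t" using V(3) W(3) \<sigma> x hpos by (auto simp: E_def)
  have EJ: "t \<in> g ` J\<^sub>2" if "t \<in> E" for t
    using that xJ hJ V(3) W(3) \<sigma> g0 assms(6) by (force simp: E_def)
  have "\<exists>c. (\<forall>b\<in>E. 0 \<le> c b) \<and> (\<forall>t\<in>E. k t = (\<Sum>b\<in>E. c b * max 0 (t - b)))"
  proof (rule angle_decomposition[where D = E and \<phi> = k, OF _ _ E k0])
    show "finite E" "0 \<in> E" by (simp_all add: E_def)
    show "0 \<le> k t" if "t \<in> E" for t
      using kpos[OF EJ[OF that] E[OF that]] .
    show "(k q - k p) * (r - q) \<le> (k r - k q) * (q - p)"
      if "p \<in> E" "q \<in> E" "r \<in> E" "p < q" "q < r" for p q r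
      using that by (intro kslope EJ)
  qed
  then obtain e where e: "\<And>b. b \<in> E \<Longrightarrow> 0 \<le> e b" "\<And>t. t \<in> E \<Longrightarrow> k t = (\<Sum>b\<in>E. e b * max 0 (t - b))"
    by blast
  have "weakly_majorized (k \<circ> x) (k \<circ> (h \<circ> \<sigma>))"
    by (rule weakly_majorized_angle_sum[where D = E and c = e, OF xh E e(1)])
      (assumption | rule e(2), simp add: E_def)+
  moreover have khf: "k \<circ> (h \<circ> \<delta>) = f \<circ> \<delta>" if "\<And>i. 0 \<le> \<delta> i" for \<delta> :: "'n \<Rightarrow> real"
    using kh that by (simp add: fun_eq_iff)
  ultimately have second: "weakly_majorized (k \<circ> x) (f \<circ> \<sigma>)" using \<sigma> by simp
  \<comment> \<open>Reads f(A) + f(B) as k(h(A)) + k(h(B)), so that the matrix majorization applies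
    to \<open>k\<close>.\<close>
  have Z': "conj_diag V (k \<circ> (h \<circ> \<alpha>)) + conj_diag W (k \<circ> (h \<circ> \<beta>)) = conj_diag Q z"
    using Z V(3) W(3) by (simp add: khf)
  have first: "weakly_majorized z (k \<circ> x)"
  proof (rule convex_weakly_majorized[where D = E and c = e, OF V(1) W(1) U Q _ _ X Z' E e(1)])
    show "k t = (\<Sum>b\<in>E. e b * max 0 (t - b))" if "t \<in> range (h \<circ> \<alpha>) \<union> range (h \<circ> \<beta>) \<union> range x" for t
      by (rule e(2)) (use that in \<open>auto simp: E_def\<close>)
  qed (use V(3) W(3) hpos in auto)
  have eqs: "mat_fun f A + mat_fun f B = conj_diag Q z"
    "mat_fun (the_inv_into J\<^sub>2 g) (mat_fun (g \<circ> f) A + mat_fun (g \<circ> f) B) = conj_diag U (k \<circ> x)"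
    "mat_fun f (A + B) = conj_diag R (f \<circ> \<sigma>)"
    unfolding V(2) W(2) S by (simp_all add: mat_fun_conj_diag V(1) W(1) R U Z X flip: h_def k_def)
  show ?thesis
    unfolding eqs unitarily_invariant_conj_diag[OF N Q] unitarily_invariant_conj_diag[OF N U]
      unitarily_invariant_conj_diag[OF N R]
    using weakly_majorized_norm_le[OF N first z] weakly_majorized_norm_le[OF N second]
      kpos[OF xJ x] assms(5) \<sigma> by simp
qed

end
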